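(* Let $R$ and $C$ be disjoint finite or countable sets and let $I\subseteq R\times C$. The following are equivalent. (a) For all $\varphi\in c_0(I)$ one has $\bigl\|\sum_{(r,c)\in I}\varphi_{rc}\,\mathrm e_c\otimes\mathrm e_r\bigr\|_{c_0(C)\widehat\otimes\, c_0(R)}=\sup_{q\in I}|\varphi_q|$. (b) There are pairwise disjoint sets $R_j\subseteq R$ and pairwise disjoint sets $C_j\subseteq C$ such that $R_j$ or $C_j$ is a singleton for each $j$ and $I=\bigcup_j R_j\times C_j$. (c) $I$ is a union of pairwise disjoint star graphs: every path in $I$ has length at most $2$.
   Context: $c_0(C)\widehat\otimes\, c_0(R)$ is the projective tensor product (completion of the algebraic tensor product for the projective tensor norm). The coefficient of a tensor $u$ at $(r,c)$ is $\langle\mathrm e_c\otimes\mathrm e_r,u\rangle$, and $\sum_{(r,c)\in I}\varphi_{rc}\,\mathrm e_c\otimes\mathrm e_r$ denotes the tensor with coefficients $\varphi_{rc}$ at $(r,c)\in I$ and $0$ elsewhere; (a) includes the assertion that this tensor is in the space. $I$ is identified with the bipartite graph on $C\amalg R$ with edges $\{r,c\}$, $(r,c)\in I$. A path of length $s$ is a sequence $(v_0,\dots,v_s)$ of pairwise distinct vertices with consecutive vertices adjacent. *)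

theory Defs
  imports "HOL-Analysis.Analysis"
begin

text \<open>
  The scalar field is a type \<open>'k\<close>; the intended instances are \<^typ>\<open>real\<close> and \<^typ>\<open>complex\<close>,
  up to isometry the only ones in the sort \<open>{real_normed_field, euclidean_space}\<close>. Vectors of \<open>c\<^sub>0(S)\<close> are functions on the whole index type
  that vanish off \<open>S\<close>.
\<close>

definition c0 :: "'i set \<Rightarrow> ('i \<Rightarrow> 'k::real_normed_field) set" where
  "c0 S = {x. (\<forall>i. i \<notin> S \<longrightarrow> x i = 0) \<and> (x \<longlongrightarrow> 0) cofinite}"

text \<open>
  Since \<open>x\<close> vanishes off \<open>S\<close>, the supremum over the whole (nonempty) type is the supremum
  over \<open>S\<close>, with the convention that it is \<open>0\<close> if \<open>S\<close> is empty.
\<close>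

definition sup_norm :: "('i \<Rightarrow> 'k::real_normed_field) \<Rightarrow> real" where
  "sup_norm x = (SUP i. norm (x i))"

definition linear_form_on :: "('i \<Rightarrow> 'k::real_normed_field) set \<Rightarrow> (('i \<Rightarrow> 'k) \<Rightarrow> 'k) \<Rightarrow> bool" where
  "linear_form_on V f \<longleftrightarrow>
     (\<forall>x\<in>V. \<forall>y\<in>V. f (\<lambda>i. x i + y i) = f x + f y) \<and>
     (\<forall>a. \<forall>x\<in>V. f (\<lambda>i. a * x i) = a * f x)"

type_synonym ('i, 'j, 'k) form2 = "('i \<Rightarrow> 'k) \<Rightarrow> ('j \<Rightarrow> 'k) \<Rightarrow> 'k"

definition bilinear_forms ::
    "'i set \<Rightarrow> 'j set \<Rightarrow> ('i, 'j, 'k::real_normed_field) form2 set" where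
  "bilinear_forms C R =
     {B. (\<forall>y\<in>c0 R. linear_form_on (c0 C) (\<lambda>x. B x y)) \<and>
         (\<forall>x\<in>c0 C. linear_form_on (c0 R) (B x))}"

text \<open>
  The algebraic tensor product is realised inside the algebraic dual of the space of all
  (not necessarily bounded) bilinear forms on \<open>c\<^sub>0(C) \<times> c\<^sub>0(R)\<close>: the elementary tensor
  \<open>x \<otimes> y\<close> is the evaluation \<open>B \<mapsto> B x y\<close>. A list of pairs stands for the finite sum of the
  corresponding elementary tensors; scalar factors are absorbed in these.
  The value \<open>0\<close> off \<^const>\<open>bilinear_forms\<close> makes equality of tensors extensional.
\<close>

definition tensor_sum ::
    "'i set \<Rightarrow> 'j set \<Rightarrow> (('i \<Rightarrow> 'k) \<times> ('j \<Rightarrow> 'k)) list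
      \<Rightarrow> ('i, 'j, 'k::real_normed_field) form2 \<Rightarrow> 'k" where
  "tensor_sum C R ps = (\<lambda>B. if B \<in> bilinear_forms C R then \<Sum>(x, y)\<leftarrow>ps. B x y else 0)"

definition alg_tensor ::
    "'i set \<Rightarrow> 'j set \<Rightarrow> (('i, 'j, 'k::real_normed_field) form2 \<Rightarrow> 'k) set" where
  "alg_tensor C R = tensor_sum C R ` lists (c0 C \<times> c0 R)"

definition proj_norm ::
    "'i set \<Rightarrow> 'j set \<Rightarrow> (('i, 'j, 'k::real_normed_field) form2 \<Rightarrow> 'k) \<Rightarrow> real" where
  "proj_norm C R u =
     Inf {\<Sum>(x, y)\<leftarrow>ps. sup_norm x * sup_norm y | ps.
            ps \<in> lists (c0 C \<times> c0 R) \<and> u = tensor_sum C R ps}"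

text \<open>
  The projective tensor product is the completion of the algebraic one: Cauchy sequences
  modulo sequences whose distance tends to \<open>0\<close>. Its elements are equivalence classes; the norm
  and the coefficients are the limits along any representative.
\<close>

definition tensor_Cauchy ::
    "'i set \<Rightarrow> 'j set \<Rightarrow> (nat \<Rightarrow> ('i, 'j, 'k::real_normed_field) form2 \<Rightarrow> 'k) set" where
  "tensor_Cauchy C R =
     {U. (\<forall>n. U n \<in> alg_tensor C R) \<and>
         (\<forall>e>0. \<exists>N. \<forall>m\<ge>N. \<forall>n\<ge>N. proj_norm C R (\<lambda>B. U m B - U n B) < e)}"

definition tensor_rel ::
    "'i set \<Rightarrow> 'j set \<Rightarrow> (nat \<Rightarrow> ('i, 'j, 'k::real_normed_field) form2 \<Rightarrow> 'k) rel" where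
  "tensor_rel C R =
     {(U, V). U \<in> tensor_Cauchy C R \<and> V \<in> tensor_Cauchy C R \<and>
              (\<lambda>n. proj_norm C R (\<lambda>B. U n B - V n B)) \<longlonglongrightarrow> 0}"

definition proj_tensor ::
    "'i set \<Rightarrow> 'j set \<Rightarrow> (nat \<Rightarrow> ('i, 'j, 'k::real_normed_field) form2 \<Rightarrow> 'k) set set" where
  "proj_tensor C R = tensor_Cauchy C R // tensor_rel C R"

definition proj_tensor_norm ::
    "'i set \<Rightarrow> 'j set \<Rightarrow> (nat \<Rightarrow> ('i, 'j, 'k::real_normed_field) form2 \<Rightarrow> 'k) set \<Rightarrow> real" where
  "proj_tensor_norm C R u = (THE l. \<forall>U\<in>u. (\<lambda>n. proj_norm C R (U n)) \<longlonglongrightarrow> l)"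

text \<open>
  The pairing \<open>\<langle>e\<^sub>c \<otimes> e\<^sub>r, u\<rangle>\<close> evaluates \<open>u\<close> at the bilinear form \<open>(x, y) \<mapsto> x\<^sub>c y\<^sub>r\<close>.
\<close>

definition tensor_coeff ::
    "(nat \<Rightarrow> ('i, 'j, 'k::real_normed_field) form2 \<Rightarrow> 'k) set \<Rightarrow> 'j \<Rightarrow> 'i \<Rightarrow> 'k" where
  "tensor_coeff u r c = (THE l. \<forall>U\<in>u. (\<lambda>n. U n (\<lambda>x y. x c * y r)) \<longlonglongrightarrow> l)"

text \<open>
  A tensor is determined by its coefficients, because \<open>c\<^sub>0\<close> has the approximation property.
  This is stated as a predicate so that uniqueness need not be presupposed: an assertion about
  ``the'' tensor with given coefficients is existence together with a claim on all such tensors.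
\<close>

definition tensor_with_coeffs ::
    "'v set \<Rightarrow> 'v set \<Rightarrow> ('v \<times> 'v) set \<Rightarrow> ('v \<times> 'v \<Rightarrow> 'k)
      \<Rightarrow> (nat \<Rightarrow> ('v, 'v, 'k::real_normed_field) form2 \<Rightarrow> 'k) set \<Rightarrow> bool" where
  "tensor_with_coeffs C R I \<phi> u \<longleftrightarrow>
     u \<in> proj_tensor C R \<and>
     (\<forall>r\<in>R. \<forall>c\<in>C. tensor_coeff u r c = (if (r, c) \<in> I then \<phi> (r, c) else 0))"

definition graph_edges :: "('v \<times> 'v) set \<Rightarrow> 'v set set" where
  "graph_edges I = {{r, c} | r c. (r, c) \<in> I}"

definition graph_path :: "'v set \<Rightarrow> 'v set set \<Rightarrow> nat \<Rightarrow> (nat \<Rightarrow> 'v) \<Rightarrow> bool" where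
  "graph_path V E s v \<longleftrightarrow>
     v ` {..s} \<subseteq> V \<and> inj_on v {..s} \<and> (\<forall>i<s. {v i, v (Suc i)} \<in> E)"

text \<open>
  A star graph is given by its edges, which join a centre \<open>v\<close> to the leaves; \<open>\<Union>E\<close> is its set of
  vertices, isolated vertices being ignored. Disjointness of stars means that they share
  no vertex.
\<close>

definition star_graph :: "'v set set \<Rightarrow> bool" where
  "star_graph E \<longleftrightarrow> (\<exists>v L. v \<notin> L \<and> E = (\<lambda>w. {v, w}) ` L)"

definition union_of_disjoint_stars :: "'v set set \<Rightarrow> bool" where
  "union_of_disjoint_stars E \<longleftrightarrow>
     (\<exists>S. (\<forall>F\<in>S. star_graph F) \<and> pairwise (\<lambda>F G. \<Union>F \<inter> \<Union>G = {}) S \<and> E = \<Union>S)"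

end

theory Submission
  imports Defs
begin

text \<open>
  If \<open>I\<close> contains the edges of a path of length three, a bilinear form of norm at most \<open>2 * sqrt 2\<close>
  takes the value \<open>3\<close> at the tensor with coefficients \<open>1\<close> on this path, so the projective norm of
  that tensor exceeds \<open>1\<close>. If there is no such path, \<open>I\<close> decomposes into stars, and a tensor supported
  on finitely many points of \<open>I\<close> is a finite sum of elementary tensors \<open>x\<^sub>j \<otimes> y\<^sub>j\<close> in which the \<open>x\<^sub>j\<close>
  have pairwise disjoint supports, and likewise the \<open>y\<^sub>j\<close>. Averaging
  \<open>(\<Sum>j. \<epsilon>\<^sub>j x\<^sub>j) \<otimes> (\<Sum>j. \<epsilon>\<^sub>j y\<^sub>j)\<close> over all signs \<open>\<epsilon>\<^sub>j\<close> bounds its norm by the supremum of the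
  coefficients. The general case follows by truncating to finitely many coordinates.
\<close>

subsection \<open>The projective norm on the algebraic tensor product\<close>

text \<open>All equivalences pass through one combinatorial condition: edges \<open>(r, c)\<close>,
  \<open>(r', c)\<close>, \<open>(r', c')\<close> of \<open>I\<close> force \<open>r = r'\<close> or
  \<open>c = c'\<close>. Conditions (a) and (c) each yield it, and the stars are built from it. The
  quantitative input of the converse is a single bound for tensors with finitely many coefficients
  in \<open>I\<close>; the rest of (a) follows from it by limits. The difficulty is that (a) speaks
  of every element of the completion with the given coefficients, so of Cauchy sequences whose terms
  may have infinitely many nonzero coefficients, also off \<open>I\<close>. They are controlled on
  finite grids: truncation is a contraction, a truncated tensor is a function of its finitely many
  coefficients, and the truncations of a fixed algebraic tensor converge to it. Lower bounds for the
  norm come by duality, a form bounded by \<open>K\<close> being a functional of norm at most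
  \<open>K\<close>. The constant \<open>2 * sqrt 2\<close> is the exact norm of the path form over
  the complex numbers; over the reals the norm is 2, but one estimate below 3 serves both
  fields.\<close>

lemma c0I:
  assumes "\<And>i. i \<notin> S \<Longrightarrow> x i = 0" "(x \<longlongrightarrow> 0) cofinite"
  shows "x \<in> c0 S"
  using assms by (auto simp: c0_def)

lemma c0_vanishes: "x \<in> c0 S \<Longrightarrow> i \<notin> S \<Longrightarrow> x i = 0"
  by (auto simp: c0_def)

lemma c0_tendsto: "x \<in> c0 S \<Longrightarrow> (x \<longlongrightarrow> 0) cofinite"
  by (auto simp: c0_def)

lemma c0_add: "x \<in> c0 S \<Longrightarrow> y \<in> c0 S \<Longrightarrow> (\<lambda>i. x i + y i) \<in> c0 S"
  using tendsto_add_zero[of x cofinite y] by (auto simp: c0_def)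

lemma c0_mult: "x \<in> c0 S \<Longrightarrow> (\<lambda>i. a * x i) \<in> c0 S"
  using tendsto_mult_right_zero[of x cofinite a] by (auto simp: c0_def)

lemma c0_diff: "x \<in> c0 S \<Longrightarrow> y \<in> c0 S \<Longrightarrow> (\<lambda>i. x i - y i) \<in> c0 S"
  using tendsto_diff[of x 0 cofinite y 0] by (auto simp: c0_def)

lemma finite_c0_large:
  assumes "x \<in> c0 S" "e > 0"
  shows "finite {i. norm (x i) \<ge> e}"
  using tendstoD[OF c0_tendsto[OF assms(1)] assms(2)]
  by (simp add: eventually_cofinite not_less)

lemma c0_finite_support:
  assumes "finite A" "A \<subseteq> S" "\<And>i. i \<notin> A \<Longrightarrow> x i = 0"
  shows "x \<in> c0 S"
proof (rule c0I)
  show "x i = 0" if "i \<notin> S" for i using assms that by blast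
  have "{i. x i \<noteq> 0} \<subseteq> A" using assms(3) by blast
  then have "eventually (\<lambda>i. x i = 0) cofinite"
    unfolding eventually_cofinite using assms(1) finite_subset by blast
  then show "(x \<longlongrightarrow> 0) cofinite" by (rule tendsto_eventually)
qed

text \<open>Off the finite set where \<open>norm (x i)\<close> is at least 1 the values are below 1,
  and on it they are at most their sum. Boundedness gives the \<open>SUP\<close> in
  \<open>sup_norm\<close> its meaning.\<close>

lemma bdd_above_c0:
  assumes "x \<in> c0 S"
  shows "bdd_above (range (\<lambda>i. norm (x i)))"
proof -
  define A where "A = {i. norm (x i) \<ge> 1}"
  have A: "finite A" unfolding A_def using finite_c0_large[OF assms] by simp
  have "norm (x i) \<le> 1 + (\<Sum>j\<in>A. norm (x j))" for i
  proof (cases "i \<in> A")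
    case True
    then have "norm (x i) \<le> (\<Sum>j\<in>A. norm (x j))"
      using A by (intro member_le_sum) auto
    then show ?thesis by simp
  next
    case False
    then have "norm (x i) \<le> 1" by (simp add: A_def)
    moreover have "0 \<le> (\<Sum>j\<in>A. norm (x j))" by (intro sum_nonneg) simp
    ultimately show ?thesis by linarith
  qed
  then show ?thesis by (auto intro!: bdd_aboveI)
qed

lemma norm_le_sup_norm: "x \<in> c0 S \<Longrightarrow> norm (x i) \<le> sup_norm x"
  unfolding sup_norm_def by (rule cSUP_upper) (auto intro: bdd_above_c0)

lemma sup_norm_le: "(\<And>i. norm (x i) \<le> M) \<Longrightarrow> sup_norm x \<le> M"
  unfolding sup_norm_def by (rule cSUP_least) auto

lemma sup_norm_nonneg: "x \<in> c0 S \<Longrightarrow> 0 \<le> sup_norm x"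
  by (rule order_trans[OF norm_ge_zero norm_le_sup_norm])

lemma sup_norm_mult_le:
  "x \<in> c0 S \<Longrightarrow> sup_norm (\<lambda>i. a * x i) \<le> norm a * sup_norm x"
  by (rule sup_norm_le) (simp add: norm_mult mult_left_mono norm_le_sup_norm)

definition unit_vec :: "'i \<Rightarrow> 'i \<Rightarrow> 'k::real_normed_field" where
  "unit_vec j = (\<lambda>i. if i = j then 1 else 0)"

lemma unit_vec_in_c0: "j \<in> S \<Longrightarrow> unit_vec j \<in> c0 S"
  by (rule c0_finite_support[of "{j}"]) (auto simp: unit_vec_def)

definition trunc :: "'i set \<Rightarrow> ('i \<Rightarrow> 'k::real_normed_field) \<Rightarrow> 'i \<Rightarrow> 'k" where
  "trunc A x = (\<lambda>i. if i \<in> A then x i else 0)"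

lemma trunc_in_c0:
  assumes "x \<in> c0 S"
  shows "trunc A x \<in> c0 S"
proof (rule c0I)
  show "trunc A x i = 0" if "i \<notin> S" for i
    using c0_vanishes[OF assms that] by (simp add: trunc_def)
  show "(trunc A x \<longlongrightarrow> 0) cofinite"
    by (rule Lim_null_comparison[OF _ tendsto_norm_zero[OF c0_tendsto[OF assms]]])
       (auto simp: trunc_def)
qed

lemma sup_norm_trunc_le: "x \<in> c0 S \<Longrightarrow> sup_norm (trunc A x) \<le> sup_norm x"
  by (rule sup_norm_le)
     (auto simp: trunc_def norm_le_sup_norm intro: sup_norm_nonneg)

text \<open>The limit runs along the directed set of finite subsets of \<open>S\<close>, so that no
  enumeration is chosen and the two tensor factors can later be truncated independently.\<close>

lemma trunc_tendsto:
  assumes "x \<in> c0 S"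
  shows "((\<lambda>A. sup_norm (\<lambda>i. x i - trunc A x i)) \<longlongrightarrow> 0) (finite_subsets_at_top S)"
proof (rule tendstoI)
  fix e :: real assume e: "e > 0"
  \<comment> \<open>The threshold \<open>e / 2\<close> turns the non-strict bound on the supremum
    into the strict one required.\<close>
  define A where "A = {i. norm (x i) \<ge> e / 2}"
  have "finite A" unfolding A_def using e by (intro finite_c0_large[OF assms]) simp
  moreover have "A \<subseteq> S"
  proof
    fix i assume "i \<in> A"
    then have "x i \<noteq> 0" using e by (auto simp: A_def)
    then show "i \<in> S" using c0_vanishes[OF assms] by blast
  qed
  moreover have "dist (sup_norm (\<lambda>i. x i - trunc D x i)) 0 < e" if "A \<subseteq> D" for D
  proof -
    have "norm (x i - trunc D x i) \<le> e / 2" for i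
    proof (cases "i \<in> D")
      case True
      then show ?thesis using e by (simp add: trunc_def)
    next
      case False
      then have "i \<notin> A" using that by blast
      then show ?thesis using False by (simp add: A_def trunc_def not_le less_imp_le)
    qed
    then have "sup_norm (\<lambda>i. x i - trunc D x i) \<le> e / 2" by (rule sup_norm_le)
    moreover have "0 \<le> sup_norm (\<lambda>i. x i - trunc D x i)"
      by (rule sup_norm_nonneg[OF c0_diff[OF assms trunc_in_c0[OF assms]]])
    ultimately show ?thesis using e by simp
  qed
  ultimately show "\<forall>\<^sub>F D in finite_subsets_at_top S. dist (sup_norm (\<lambda>i. x i - trunc D x i)) 0 < e"
    unfolding eventually_finite_subsets_at_top by blast
qed

section \<open>Bilinear forms and their expansion in unit vectors\<close>

lemma bilinear_form_add_left:
  "B \<in> bilinear_forms C R \<Longrightarrow> x \<in> c0 C \<Longrightarrow> x' \<in> c0 C \<Longrightarrow> y \<in> c0 R \<Longrightarrow>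
    B (\<lambda>i. x i + x' i) y = B x y + B x' y"
  and bilinear_form_add_right:
  "B \<in> bilinear_forms C R \<Longrightarrow> x \<in> c0 C \<Longrightarrow> y \<in> c0 R \<Longrightarrow> y' \<in> c0 R \<Longrightarrow>
    B x (\<lambda>i. y i + y' i) = B x y + B x y'"
  and bilinear_form_mult_left:
  "B \<in> bilinear_forms C R \<Longrightarrow> x \<in> c0 C \<Longrightarrow> y \<in> c0 R \<Longrightarrow> B (\<lambda>i. a * x i) y = a * B x y"
  and bilinear_form_mult_right:
  "B \<in> bilinear_forms C R \<Longrightarrow> x \<in> c0 C \<Longrightarrow> y \<in> c0 R \<Longrightarrow> B x (\<lambda>i. a * y i) = a * B x y"
  by (simp_all add: bilinear_forms_def linear_form_on_def)

lemma bilinear_form_diff_left: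
  assumes "B \<in> bilinear_forms C R" "x \<in> c0 C" "x' \<in> c0 C" "y \<in> c0 R"
  shows "B (\<lambda>i. x i - x' i) y = B x y - B x' y"
  using bilinear_form_add_left[OF assms(1) c0_diff[OF assms(2,3)] assms(3,4)]
  by (simp add: algebra_simps)

lemma bilinear_form_diff_right:
  assumes "B \<in> bilinear_forms C R" "x \<in> c0 C" "y \<in> c0 R" "y' \<in> c0 R"
  shows "B x (\<lambda>i. y i - y' i) = B x y - B x y'"
  using bilinear_form_add_right[OF assms(1,2) c0_diff[OF assms(3,4)] assms(4)]
  by (simp add: algebra_simps)

lemma linear_form_on_add:
  "linear_form_on V f \<Longrightarrow> x \<in> V \<Longrightarrow> y \<in> V \<Longrightarrow> f (\<lambda>i. x i + y i) = f x + f y"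
  and linear_form_on_mult:
  "linear_form_on V f \<Longrightarrow> x \<in> V \<Longrightarrow> f (\<lambda>i. a * x i) = a * f x"
  by (simp_all add: linear_form_on_def)

text \<open>The form is not assumed continuous, so its values on unit vectors determine it only on
  finitely supported vectors. The induction peels off one coordinate at a time.\<close>

lemma linear_form_expand:
  assumes f: "linear_form_on (c0 S) f" and "finite A"
  shows "A \<subseteq> S \<Longrightarrow> (\<And>i. i \<notin> A \<Longrightarrow> x i = 0) \<Longrightarrow> f x = (\<Sum>i\<in>A. x i * f (unit_vec i))"
  using assms(2)
proof (induction A arbitrary: x rule: finite_induct)
  case empty
  then have x: "x = (\<lambda>i. 0)" by auto
  then have "x \<in> c0 S" by (intro c0_finite_support[of "{}"]) auto
  then have "f (\<lambda>i. 0 * x i) = 0 * f x"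
    by (rule linear_form_on_mult[OF f])
  then show ?case using x by simp
next
  case (insert j A)
  let ?z = "\<lambda>i. if i = j then 0 else x i"
  let ?w = "\<lambda>i. x j * unit_vec j i"
  have z: "?z \<in> c0 S"
    by (rule c0_finite_support[of A]) (use insert in auto)
  have j: "unit_vec j \<in> c0 S" using insert by (intro unit_vec_in_c0) auto
  have "x = (\<lambda>i. ?z i + ?w i)" by (auto simp: unit_vec_def)
  then have "f x = f (\<lambda>i. ?z i + ?w i)" by metis
  also have "\<dots> = f ?z + f ?w"
    by (rule linear_form_on_add[OF f z c0_mult[OF j]])
  also have "f ?w = x j * f (unit_vec j)"
    by (rule linear_form_on_mult[OF f j])
  also have "f ?z = (\<Sum>i\<in>A. ?z i * f (unit_vec i))"
    using insert by (intro insert.IH) auto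
  also have "\<dots> = (\<Sum>i\<in>A. x i * f (unit_vec i))"
    using insert by (intro sum.cong) auto
  finally show ?case using insert by simp
qed

lemma bilinear_form_expand_left:
  assumes "B \<in> bilinear_forms C R" "y \<in> c0 R" "finite A" "A \<subseteq> C" "\<And>i. i \<notin> A \<Longrightarrow> x i = 0"
  shows "B x y = (\<Sum>c\<in>A. x c * B (unit_vec c) y)"
  by (rule linear_form_expand[of C "\<lambda>x. B x y"]) (use assms in \<open>auto simp: bilinear_forms_def\<close>)

lemma bilinear_form_expand_right:
  assumes "B \<in> bilinear_forms C R" "x \<in> c0 C" "finite D" "D \<subseteq> R" "\<And>i. i \<notin> D \<Longrightarrow> y i = 0"
  shows "B x y = (\<Sum>r\<in>D. y r * B x (unit_vec r))"
  by (rule linear_form_expand[of R "B x"]) (use assms in \<open>auto simp: bilinear_forms_def\<close>)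

text \<open>The form that \<open>tensor_coeff\<close> evaluates at. Its arguments follow the order
  of the tensor factors, column before row, while points of \<open>I\<close> are pairs (row,
  column).\<close>

definition coeff_form :: "'i \<Rightarrow> 'j \<Rightarrow> ('i, 'j, 'k::real_normed_field) form2" where
  "coeff_form c r = (\<lambda>x y. x c * y r)"

lemma coeff_form_bilinear: "coeff_form c r \<in> bilinear_forms C R"
  by (simp add: coeff_form_def bilinear_forms_def linear_form_on_def algebra_simps)

section \<open>Calculus of algebraic tensors\<close>

lemma tensor_sum_Nil: "tensor_sum C R [] = (\<lambda>B. 0)"
  by (auto simp: tensor_sum_def)

lemma tensor_sum_append:
  "tensor_sum C R (ps @ qs) = (\<lambda>B. tensor_sum C R ps B + tensor_sum C R qs B)"
  by (auto simp: tensor_sum_def)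

lemma tensor_sum_mult:
  assumes "ps \<in> lists (c0 C \<times> c0 R)"
  shows "tensor_sum C R (map (\<lambda>(x, y). ((\<lambda>i. a * x i), y)) ps) = (\<lambda>B. a * tensor_sum C R ps B)"
proof
  fix B
  show "tensor_sum C R (map (\<lambda>(x, y). ((\<lambda>i. a * x i), y)) ps) B = a * tensor_sum C R ps B"
    using assms
    by (induction ps)
       (auto simp: tensor_sum_def bilinear_form_mult_left distrib_left split: if_splits)
qed

lemma alg_tensorE:
  assumes "u \<in> alg_tensor C R"
  obtains ps where "ps \<in> lists (c0 C \<times> c0 R)" "u = tensor_sum C R ps"
  using assms by (auto simp: alg_tensor_def)

lemma tensor_sum_in_alg_tensor: "ps \<in> lists (c0 C \<times> c0 R) \<Longrightarrow> tensor_sum C R ps \<in> alg_tensor C R"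
  by (auto simp: alg_tensor_def)

lemma alg_tensor_add:
  assumes "u \<in> alg_tensor C R" "v \<in> alg_tensor C R"
  shows "(\<lambda>B. u B + v B) \<in> alg_tensor C R"
proof -
  obtain ps qs where "ps \<in> lists (c0 C \<times> c0 R)" "u = tensor_sum C R ps"
    "qs \<in> lists (c0 C \<times> c0 R)" "v = tensor_sum C R qs"
    using assms by (auto elim!: alg_tensorE)
  then have "(\<lambda>B. u B + v B) = tensor_sum C R (ps @ qs)" "ps @ qs \<in> lists (c0 C \<times> c0 R)"
    by (auto simp: tensor_sum_append)
  then show ?thesis by (metis tensor_sum_in_alg_tensor)
qed

lemma lists_mult_left:
  "ps \<in> lists (c0 C \<times> c0 R) \<Longrightarrow> map (\<lambda>(x, y). ((\<lambda>i. a * x i), y)) ps \<in> lists (c0 C \<times> c0 R)"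
  by (induction ps) (auto intro: c0_mult)

lemma alg_tensor_mult:
  assumes "u \<in> alg_tensor C R"
  shows "(\<lambda>B. a * u B) \<in> alg_tensor C R"
proof -
  obtain ps where "ps \<in> lists (c0 C \<times> c0 R)" "u = tensor_sum C R ps"
    using assms by (auto elim!: alg_tensorE)
  then show ?thesis
    using tensor_sum_in_alg_tensor[OF lists_mult_left, of ps C R a] by (simp add: tensor_sum_mult)
qed

lemma alg_tensor_diff:
  assumes "u \<in> alg_tensor C R" "v \<in> alg_tensor C R"
  shows "(\<lambda>B. u B - v B) \<in> alg_tensor C R"
  using alg_tensor_add[OF assms(1) alg_tensor_mult[OF assms(2), of "-1"]] by simp

lemma alg_tensor_zero: "(\<lambda>B. 0) \<in> alg_tensor C R"
  using tensor_sum_in_alg_tensor[of "[]" C R] by (simp add: tensor_sum_Nil)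

lemma alg_tensor_sum:
  "finite A \<Longrightarrow> (\<And>j. j \<in> A \<Longrightarrow> u j \<in> alg_tensor C R) \<Longrightarrow> (\<lambda>B. \<Sum>j\<in>A. u j B) \<in> alg_tensor C R"
  by (induction A rule: finite_induct) (auto intro: alg_tensor_zero alg_tensor_add)

lemma elementary_in_alg_tensor: "x \<in> c0 C \<Longrightarrow> y \<in> c0 R \<Longrightarrow> tensor_sum C R [(x, y)] \<in> alg_tensor C R"
  by (rule tensor_sum_in_alg_tensor) simp

section \<open>Seminorm properties of \<open>proj_norm\<close> and duality with bounded
  forms\<close>

lemma proj_cost_nonneg:
  "ps \<in> lists (c0 C \<times> c0 R) \<Longrightarrow> 0 \<le> (\<Sum>(x, y)\<leftarrow>ps. sup_norm x * sup_norm y)"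
  by (induction ps) (auto intro!: add_nonneg_nonneg mult_nonneg_nonneg intro: sup_norm_nonneg)

lemma proj_norm_le:
  assumes "ps \<in> lists (c0 C \<times> c0 R)"
  shows "proj_norm C R (tensor_sum C R ps) \<le> (\<Sum>(x, y)\<leftarrow>ps. sup_norm x * sup_norm y)"
  unfolding proj_norm_def
  by (rule cInf_lower) (use assms in \<open>auto intro!: bdd_belowI[of _ 0] proj_cost_nonneg\<close>)

lemma proj_norm_greatest:
  assumes "u \<in> alg_tensor C R"
    and "\<And>ps. ps \<in> lists (c0 C \<times> c0 R) \<Longrightarrow> u = tensor_sum C R ps \<Longrightarrow>
      M \<le> (\<Sum>(x, y)\<leftarrow>ps. sup_norm x * sup_norm y)"
  shows "M \<le> proj_norm C R u"
  unfolding proj_norm_def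
  by (rule cInf_greatest) (use assms in \<open>auto elim!: alg_tensorE\<close>)

lemma proj_norm_nonneg: "u \<in> alg_tensor C R \<Longrightarrow> 0 \<le> proj_norm C R u"
  by (rule proj_norm_greatest) (auto intro: proj_cost_nonneg)

lemma proj_norm_elementary_le:
  "x \<in> c0 C \<Longrightarrow> y \<in> c0 R \<Longrightarrow> proj_norm C R (tensor_sum C R [(x, y)]) \<le> sup_norm x * sup_norm y"
  using proj_norm_le[of "[(x, y)]" C R] by simp

text \<open>Concatenated representations represent the sum at the added cost. The infima are taken
  one after the other, first over lists for \<open>v\<close> with the list for \<open>u\<close>
  fixed, then over lists for \<open>u\<close>.\<close>

lemma proj_norm_add_le:
  assumes u: "u \<in> alg_tensor C R" and v: "v \<in> alg_tensor C R"
  shows "proj_norm C R (\<lambda>B. u B + v B) \<le> proj_norm C R u + proj_norm C R v"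
proof -
  let ?N = "proj_norm C R (\<lambda>B. u B + v B)"
  let ?c = "\<lambda>ps. \<Sum>(x, y)\<leftarrow>ps. sup_norm x * sup_norm y"
  have "?N - ?c ps \<le> proj_norm C R v"
    if ps: "ps \<in> lists (c0 C \<times> c0 R)" "u = tensor_sum C R ps" for ps
  proof (rule proj_norm_greatest[OF v])
    fix qs assume qs: "qs \<in> lists (c0 C \<times> c0 R)" "v = tensor_sum C R qs"
    have "ps @ qs \<in> lists (c0 C \<times> c0 R)" using ps(1) qs(1) by simp
    from proj_norm_le[OF this] show "?N - ?c ps \<le> ?c qs"
      by (simp add: tensor_sum_append ps(2) qs(2))
  qed
  then have "?N - proj_norm C R v \<le> proj_norm C R u"
    by (intro proj_norm_greatest[OF u]) (simp add: algebra_simps)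
  then show ?thesis by simp
qed

text \<open>Scaling the left factors of a representation scales its cost. The infimum is compared
  after division by \<open>norm a\<close>, hence the separate case \<open>a = 0\<close>, where any
  one representation gives the bound.\<close>

lemma proj_norm_mult_le:
  assumes u: "u \<in> alg_tensor C R"
  shows "proj_norm C R (\<lambda>B. a * u B) \<le> norm a * proj_norm C R u"
proof -
  let ?c = "\<lambda>ps. \<Sum>(x, y)\<leftarrow>ps. sup_norm x * sup_norm y"
  have le: "proj_norm C R (\<lambda>B. a * u B) \<le> norm a * ?c ps"
    if ps: "ps \<in> lists (c0 C \<times> c0 R)" "u = tensor_sum C R ps" for ps
  proof -
    have "proj_norm C R (\<lambda>B. a * u B) \<le> ?c (map (\<lambda>(x, y). ((\<lambda>i. a * x i), y)) ps)"
      using proj_norm_le[OF lists_mult_left[OF ps(1)]] by (simp add: tensor_sum_mult ps)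
    also have "\<dots> \<le> norm a * ?c ps"
      using ps(1)
    proof (induction ps)
      case (Cons p ps)
      obtain x y where p: "p = (x, y)" by force
      have "sup_norm (\<lambda>i. a * x i) * sup_norm y \<le> norm a * sup_norm x * sup_norm y"
        using Cons p by (intro mult_right_mono sup_norm_mult_le sup_norm_nonneg) auto
      then show ?case using Cons by (simp add: p distrib_left mult.assoc)
    qed simp
    finally show ?thesis .
  qed
  show ?thesis
  proof (cases "a = 0")
    case True
    obtain ps where "ps \<in> lists (c0 C \<times> c0 R)" "u = tensor_sum C R ps"
      using u by (rule alg_tensorE)
    from le[OF this] show ?thesis using True by simp
  next
    case False
    have "proj_norm C R (\<lambda>B. a * u B) / norm a \<le> proj_norm C R u"
      by (rule proj_norm_greatest[OF u]) (use False le in \<open>simp add: divide_simps mult.commute\<close>)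
    then show ?thesis using False by (simp add: divide_simps mult.commute)
  qed
qed

lemma proj_norm_minus_commute:
  assumes u: "u \<in> alg_tensor C R" and v: "v \<in> alg_tensor C R"
  shows "proj_norm C R (\<lambda>B. u B - v B) = proj_norm C R (\<lambda>B. v B - u B)"
  using proj_norm_mult_le[OF alg_tensor_diff[OF u v], of "-1"]
    proj_norm_mult_le[OF alg_tensor_diff[OF v u], of "-1"] by simp

lemma proj_norm_triangle:
  assumes "u \<in> alg_tensor C R" "v \<in> alg_tensor C R" "w \<in> alg_tensor C R"
  shows "proj_norm C R (\<lambda>B. u B - w B) \<le>
    proj_norm C R (\<lambda>B. u B - v B) + proj_norm C R (\<lambda>B. v B - w B)"
  using proj_norm_add_le[OF alg_tensor_diff[OF assms(1,2)] alg_tensor_diff[OF assms(2,3)]] by simp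

lemma proj_norm_le_diff:
  assumes "u \<in> alg_tensor C R" "v \<in> alg_tensor C R"
  shows "proj_norm C R u \<le> proj_norm C R (\<lambda>B. u B - v B) + proj_norm C R v"
  using proj_norm_add_le[OF alg_tensor_diff[OF assms] assms(2)] by simp

lemma proj_norm_zero: "proj_norm C R (\<lambda>B. 0) = 0"
proof (rule antisym)
  show "proj_norm C R (\<lambda>B. 0) \<le> 0"
    using proj_norm_le[of "[]" C R] by (simp add: tensor_sum_Nil)
qed (rule proj_norm_nonneg[OF alg_tensor_zero])

lemma proj_norm_sum_le:
  "finite A \<Longrightarrow> (\<And>j. j \<in> A \<Longrightarrow> u j \<in> alg_tensor C R) \<Longrightarrow>
    proj_norm C R (\<lambda>B. \<Sum>j\<in>A. u j B) \<le> (\<Sum>j\<in>A. proj_norm C R (u j))"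
proof (induction A rule: finite_induct)
  case empty
  then show ?case by (simp add: proj_norm_zero)
next
  case (insert k A)
  have "proj_norm C R (\<lambda>B. u k B + (\<Sum>j\<in>A. u j B))
      \<le> proj_norm C R (u k) + proj_norm C R (\<lambda>B. \<Sum>j\<in>A. u j B)"
    using insert by (intro proj_norm_add_le alg_tensor_sum) auto
  then show ?case using insert by fastforce
qed

text \<open>The source of the nontrivial lower bounds: applied termwise to a representation, the
  form has value at most \<open>K\<close> times its cost. It is used with \<open>K = 1\<close> for
  coefficients and with \<open>K = 2 * sqrt 2\<close> for the path form.\<close>

lemma norm_apply_le_proj_norm:
  assumes B: "B \<in> bilinear_forms C R" and u: "u \<in> alg_tensor C R" and K: "K > 0"
    and bound: "\<And>x y. x \<in> c0 C \<Longrightarrow> y \<in> c0 R \<Longrightarrow> norm (B x y) \<le> K * (sup_norm x * sup_norm y)"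
  shows "norm (u B) \<le> K * proj_norm C R u"
proof -
  have "norm (u B) / K \<le> proj_norm C R u"
  proof (rule proj_norm_greatest[OF u])
    fix ps assume ps: "ps \<in> lists (c0 C \<times> c0 R)" "u = tensor_sum C R ps"
    have "norm (\<Sum>(x, y)\<leftarrow>ps. B x y) \<le> K * (\<Sum>(x, y)\<leftarrow>ps. sup_norm x * sup_norm y)"
      using ps(1)
    proof (induction ps)
      case (Cons p ps)
      obtain x y where p: "p = (x, y)" by force
      have "norm (B x y) \<le> K * (sup_norm x * sup_norm y)" using bound Cons p by auto
      then show ?case using Cons by (auto simp: p distrib_left intro: norm_triangle_le)
    qed simp
    then show "norm (u B) / K \<le> (\<Sum>(x, y)\<leftarrow>ps. sup_norm x * sup_norm y)"
      using B K by (simp add: ps(2) tensor_sum_def divide_simps mult.commute)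
  qed
  then show ?thesis using K by (simp add: divide_simps mult.commute)
qed

text \<open>Coefficients are contractive functionals. Hence they pass to the completion, and no
  tensor has norm below the supremum of its coefficients.\<close>

lemma norm_coeff_le_proj_norm:
  assumes "u \<in> alg_tensor C R"
  shows "norm (u (coeff_form c r)) \<le> proj_norm C R u"
proof -
  have "norm (coeff_form c r x y) \<le> 1 * (sup_norm x * sup_norm y)"
    if "x \<in> c0 C" "y \<in> c0 R" for x y
    using that by (auto simp: coeff_form_def norm_mult
      intro!: mult_mono norm_le_sup_norm sup_norm_nonneg)
  from norm_apply_le_proj_norm[OF coeff_form_bilinear assms _ this] show ?thesis by simp
qed

subsection \<open>Truncation and the completion\<close>

text \<open>The finite case of the tensor in (a). The value 0 off \<open>bilinear_forms\<close>
  agrees with \<open>tensor_sum\<close>, so equality of tensors remains equality of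
  functions.\<close>

definition coeff_tensor ::
    "'i set \<Rightarrow> 'j set \<Rightarrow> ('j \<times> 'i) set \<Rightarrow> ('j \<times> 'i \<Rightarrow> 'k)
      \<Rightarrow> ('i, 'j, 'k::real_normed_field) form2 \<Rightarrow> 'k" where
  "coeff_tensor C R Q \<psi> =
     (\<lambda>B. if B \<in> bilinear_forms C R then \<Sum>(r, c)\<in>Q. \<psi> (r, c) * B (unit_vec c) (unit_vec r) else 0)"

lemma coeff_tensor_elementary:
  "coeff_tensor C R Q \<psi> =
     (\<lambda>B. \<Sum>q\<in>Q. \<psi> q * tensor_sum C R [(unit_vec (snd q), unit_vec (fst q))] B)"
  by (auto simp: coeff_tensor_def tensor_sum_def case_prod_unfold)

lemma coeff_tensor_in_alg_tensor:
  "finite Q \<Longrightarrow> Q \<subseteq> R \<times> C \<Longrightarrow> coeff_tensor C R Q \<psi> \<in> alg_tensor C R"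
  unfolding coeff_tensor_elementary
  by (intro alg_tensor_sum alg_tensor_mult elementary_in_alg_tensor unit_vec_in_c0) auto

lemma coeff_tensor_coeff:
  assumes "finite Q"
  shows "coeff_tensor C R Q \<psi> (coeff_form c r) = (if (r, c) \<in> Q then \<psi> (r, c) else 0)"
proof -
  have "coeff_tensor C R Q \<psi> (coeff_form c r) = (\<Sum>q\<in>Q. if q = (r, c) then \<psi> q else 0)"
    unfolding coeff_tensor_def
    by (auto simp: coeff_form_bilinear[unfolded coeff_form_def] coeff_form_def unit_vec_def
        case_prod_unfold prod_eq_iff intro!: sum.cong)
  then show ?thesis using assms by simp
qed

text \<open>A crude triangle bound, sufficient for error terms on a fixed finite grid whose
  coefficients tend to 0.\<close>

lemma proj_norm_coeff_tensor_le_sum: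
  fixes \<psi> :: "'j \<times> 'i \<Rightarrow> 'k::real_normed_field"
  assumes "finite Q" "Q \<subseteq> R \<times> C"
  shows "proj_norm C R (coeff_tensor C R Q \<psi>) \<le> (\<Sum>q\<in>Q. norm (\<psi> q))"
proof -
  let ?e = "\<lambda>q. tensor_sum C R [(unit_vec (snd q), unit_vec (fst q))] :: _ \<Rightarrow> 'k"
  have e: "?e q \<in> alg_tensor C R" if "q \<in> Q" for q
    using that assms(2) by (intro elementary_in_alg_tensor unit_vec_in_c0) auto
  have "proj_norm C R (coeff_tensor C R Q \<psi>) \<le> (\<Sum>q\<in>Q. proj_norm C R (\<lambda>B. \<psi> q * ?e q B))"
    unfolding coeff_tensor_elementary
    using assms(1) e by (intro proj_norm_sum_le alg_tensor_mult)
  also have "\<dots> \<le> (\<Sum>q\<in>Q. norm (\<psi> q))"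
  proof (rule sum_mono)
    fix q assume q: "q \<in> Q"
    have "proj_norm C R (?e q) \<le>
        sup_norm (unit_vec (snd q) :: _ \<Rightarrow> 'k) * sup_norm (unit_vec (fst q) :: _ \<Rightarrow> 'k)"
      using q assms(2) by (intro proj_norm_elementary_le unit_vec_in_c0) auto
    also have "\<dots> \<le> 1 * 1"
      using q assms(2)
      by (intro mult_mono sup_norm_le sup_norm_nonneg[OF unit_vec_in_c0[of _ R]])
         (auto simp: unit_vec_def)
    finally have "norm (\<psi> q) * proj_norm C R (?e q) \<le> norm (\<psi> q) * 1"
      by (intro mult_left_mono) auto
    with proj_norm_mult_le[OF e[OF q], of "\<psi> q"]
    show "proj_norm C R (\<lambda>B. \<psi> q * ?e q B) \<le> norm (\<psi> q)" by simp
  qed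
  finally show ?thesis .
qed

text \<open>The tensor product of the two coordinate projections. Since tensors are functionals on
  forms, it acts by composing the form with the projections.\<close>

definition tensor_trunc ::
    "'i set \<Rightarrow> 'j set \<Rightarrow> 'i set \<Rightarrow> 'j set \<Rightarrow> (('i, 'j, 'k::real_normed_field) form2 \<Rightarrow> 'k)
      \<Rightarrow> ('i, 'j, 'k) form2 \<Rightarrow> 'k" where
  "tensor_trunc C R A D u =
     (\<lambda>B. if B \<in> bilinear_forms C R then u (\<lambda>x y. B (trunc A x) (trunc D y)) else 0)"

lemma trunc_add: "trunc A (\<lambda>i. x i + y i) = (\<lambda>i. trunc A x i + trunc A y i)"
  and trunc_mult: "trunc A (\<lambda>i. a * x i) = (\<lambda>i. a * trunc A x i)"
  by (auto simp: trunc_def)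

lemma bilinear_form_trunc:
  assumes "B \<in> bilinear_forms C R"
  shows "(\<lambda>x y. B (trunc A x) (trunc D y)) \<in> bilinear_forms C R"
  unfolding bilinear_forms_def linear_form_on_def
  by (auto simp: trunc_add trunc_mult trunc_in_c0
      bilinear_form_add_left[OF assms] bilinear_form_add_right[OF assms]
      bilinear_form_mult_left[OF assms] bilinear_form_mult_right[OF assms])

lemma tensor_trunc_tensor_sum:
  "tensor_trunc C R A D (tensor_sum C R ps) =
     tensor_sum C R (map (\<lambda>(x, y). (trunc A x, trunc D y)) ps)"
  by (rule ext) (auto simp: tensor_trunc_def tensor_sum_def bilinear_form_trunc case_prod_unfold o_def)

lemma lists_trunc:
  "ps \<in> lists (c0 C \<times> c0 R) \<Longrightarrow>
    map (\<lambda>(x, y). (trunc A x, trunc D y)) ps \<in> lists (c0 C \<times> c0 R)"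
  by (induction ps) (auto intro: trunc_in_c0)

lemma tensor_trunc_in_alg_tensor:
  "u \<in> alg_tensor C R \<Longrightarrow> tensor_trunc C R A D u \<in> alg_tensor C R"
  by (erule alg_tensorE) (simp add: tensor_trunc_tensor_sum tensor_sum_in_alg_tensor lists_trunc del: in_lists_conv_set)

text \<open>Projections do not increase sup norms, so truncating all factors of a representation
  does not increase its cost.\<close>

lemma proj_norm_tensor_trunc_le:
  assumes "u \<in> alg_tensor C R"
  shows "proj_norm C R (tensor_trunc C R A D u) \<le> proj_norm C R u"
proof (rule proj_norm_greatest[OF assms])
  fix ps assume ps: "ps \<in> lists (c0 C \<times> c0 R)" "u = tensor_sum C R ps"
  let ?c = "\<lambda>ps. \<Sum>(x, y)\<leftarrow>ps. sup_norm x * sup_norm y"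
  have "proj_norm C R (tensor_trunc C R A D u) \<le> ?c (map (\<lambda>(x, y). (trunc A x, trunc D y)) ps)"
    using proj_norm_le[OF lists_trunc[OF ps(1)]] by (simp add: ps(2) tensor_trunc_tensor_sum)
  also have "\<dots> \<le> ?c ps"
    using ps(1)
    by (induction ps)
       (auto intro!: add_mono mult_mono sup_norm_trunc_le sup_norm_nonneg trunc_in_c0
         intro: sup_norm_nonneg)
  finally show "proj_norm C R (tensor_trunc C R A D u) \<le> ?c ps" .
qed

lemma tensor_trunc_diff:
  "tensor_trunc C R A D (\<lambda>B. u B - v B) =
    (\<lambda>B. tensor_trunc C R A D u B - tensor_trunc C R A D v B)"
  by (auto simp: tensor_trunc_def)

text \<open>After truncation the arguments of \<open>B\<close> have finite support, so
  \<open>B\<close> expands in unit vectors. This connects arbitrary algebraic tensors with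
  prescribed coefficients: on a finite grid nothing but the coefficients matters.\<close>

lemma tensor_trunc_eq_coeff_tensor:
  assumes u: "u \<in> alg_tensor C R" and A: "finite A" "A \<subseteq> C" and D: "finite D" "D \<subseteq> R"
  shows "tensor_trunc C R A D u = coeff_tensor C R (D \<times> A) (\<lambda>(r, c). u (coeff_form c r))"
proof
  fix B
  obtain ps where ps: "ps \<in> lists (c0 C \<times> c0 R)" "u = tensor_sum C R ps"
    using u by (rule alg_tensorE)
  show "tensor_trunc C R A D u B = coeff_tensor C R (D \<times> A) (\<lambda>(r, c). u (coeff_form c r)) B"
  proof (cases "B \<in> bilinear_forms C R")
    case True
    have expand: "B (trunc A x) (trunc D y) =
        (\<Sum>(r, c)\<in>D \<times> A. coeff_form c r x y * B (unit_vec c) (unit_vec r))"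
      if "x \<in> c0 C" "y \<in> c0 R" for x y
    proof -
      have "B (trunc A x) (trunc D y) = (\<Sum>r\<in>D. trunc D y r * B (trunc A x) (unit_vec r))"
        using D that by (intro bilinear_form_expand_right[OF True] trunc_in_c0) (auto simp: trunc_def)
      also have "\<dots> = (\<Sum>r\<in>D. y r * (\<Sum>c\<in>A. x c * B (unit_vec c) (unit_vec r)))"
      proof (rule sum.cong[OF refl])
        fix r assume r: "r \<in> D"
        then have "B (trunc A x) (unit_vec r) = (\<Sum>c\<in>A. trunc A x c * B (unit_vec c) (unit_vec r))"
          using A D by (intro bilinear_form_expand_left[OF True] unit_vec_in_c0) (auto simp: trunc_def)
        then show "trunc D y r * B (trunc A x) (unit_vec r) =
            y r * (\<Sum>c\<in>A. x c * B (unit_vec c) (unit_vec r))"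
          using r by (simp add: trunc_def)
      qed
      finally show ?thesis
        by (simp add: sum_distrib_left sum.cartesian_product coeff_form_def mult_ac)
    qed
    have "(\<Sum>(x, y)\<leftarrow>ps. B (trunc A x) (trunc D y)) =
        (\<Sum>(r, c)\<in>D \<times> A. (\<Sum>(x, y)\<leftarrow>ps. coeff_form c r x y) * B (unit_vec c) (unit_vec r))"
      using ps(1)
    proof (induction ps)
      case (Cons p ps)
      obtain x y where "p = (x, y)" by force
      with Cons expand[of x y] show ?case
        by (simp add: distrib_right case_prod_unfold sum.distrib)
    qed simp
    then show ?thesis
      using True
      by (simp add: ps(2) tensor_trunc_def coeff_tensor_def tensor_sum_def bilinear_form_trunc
          coeff_form_bilinear)
  qed (simp add: tensor_trunc_def coeff_tensor_def)
qed

lemma tensor_trunc_elementary_tendsto: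
  assumes x: "x \<in> c0 C" and y: "y \<in> c0 R"
  shows "((\<lambda>(A, D). proj_norm C R
      (\<lambda>B. tensor_sum C R [(x, y)] B - tensor_trunc C R A D (tensor_sum C R [(x, y)]) B)) \<longlongrightarrow> 0)
      (finite_subsets_at_top C \<times>\<^sub>F finite_subsets_at_top R)"
proof (rule tendsto_sandwich)
  let ?F = "finite_subsets_at_top C \<times>\<^sub>F finite_subsets_at_top R"
  let ?d = "\<lambda>A D B. tensor_sum C R [(x, y)] B - tensor_trunc C R A D (tensor_sum C R [(x, y)]) B"
  let ?x = "\<lambda>A i. x i - trunc A x i" and ?y = "\<lambda>D i. y i - trunc D y i"
  \<comment> \<open>The usual telescoping of a difference of products: in each term one factor tends
    to 0 while the other stays bounded.\<close>
  have d: "?d A D = (\<lambda>B. tensor_sum C R [(?x A, y)] B + tensor_sum C R [(trunc A x, ?y D)] B)" for A D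
    unfolding tensor_trunc_tensor_sum
    by (auto simp: tensor_sum_def bilinear_form_diff_left bilinear_form_diff_right trunc_in_c0 x y)
  have "proj_norm C R (?d A D) \<le> sup_norm (?x A) * sup_norm y + sup_norm x * sup_norm (?y D)" for A D
  proof -
    have "proj_norm C R (?d A D) \<le> sup_norm (?x A) * sup_norm y + sup_norm (trunc A x) * sup_norm (?y D)"
      unfolding d
      by (intro order_trans[OF proj_norm_add_le] add_mono proj_norm_elementary_le
          elementary_in_alg_tensor c0_diff trunc_in_c0 x y)
    also have "sup_norm (trunc A x) * sup_norm (?y D) \<le> sup_norm x * sup_norm (?y D)"
      by (intro mult_right_mono sup_norm_trunc_le[OF x] sup_norm_nonneg[OF c0_diff[OF y trunc_in_c0[OF y]]])
    finally show ?thesis by simp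
  qed
  then show "\<forall>\<^sub>F p in ?F. (case p of (A, D) \<Rightarrow> proj_norm C R (?d A D))
      \<le> (case p of (A, D) \<Rightarrow> sup_norm (?x A) * sup_norm y + sup_norm x * sup_norm (?y D))"
    by (simp add: case_prod_unfold)
  show "\<forall>\<^sub>F p in ?F. 0 \<le> (case p of (A, D) \<Rightarrow> proj_norm C R (?d A D))"
    by (auto intro!: always_eventually proj_norm_nonneg alg_tensor_diff tensor_trunc_in_alg_tensor
        elementary_in_alg_tensor x y)
  have "((\<lambda>p. sup_norm (?x (fst p)) * sup_norm y + sup_norm x * sup_norm (?y (snd p))) \<longlongrightarrow>
      0 * sup_norm y + sup_norm x * 0) ?F"
    by (intro tendsto_intros filterlim_compose[OF trunc_tendsto[OF x] filterlim_fst]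
        filterlim_compose[OF trunc_tendsto[OF y] filterlim_snd])
  then show "((\<lambda>(A, D). sup_norm (?x A) * sup_norm y + sup_norm x * sup_norm (?y D)) \<longlongrightarrow> 0) ?F"
    by (simp add: case_prod_unfold)
qed simp

text \<open>
  The approximation property of \<open>c\<^sub>0\<close>, which makes a tensor determined by its coefficients.
\<close>

lemma tensor_trunc_tendsto:
  fixes u :: "('i, 'j, 'k::real_normed_field) form2 \<Rightarrow> 'k"
  assumes "u \<in> alg_tensor C R"
  shows "((\<lambda>(A, D). proj_norm C R (\<lambda>B. u B - tensor_trunc C R A D u B)) \<longlongrightarrow> 0)
      (finite_subsets_at_top C \<times>\<^sub>F finite_subsets_at_top R)"
proof -
  obtain ps where ps: "ps \<in> lists (c0 C \<times> c0 R)" "u = tensor_sum C R ps"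
    using assms by (rule alg_tensorE)
  let ?F = "finite_subsets_at_top C \<times>\<^sub>F finite_subsets_at_top R"
  let ?d = "\<lambda>(ps :: (('i \<Rightarrow> 'k) \<times> ('j \<Rightarrow> 'k)) list) A D B. tensor_sum C R ps B - tensor_trunc C R A D (tensor_sum C R ps) B"
  have "((\<lambda>(A, D). proj_norm C R (?d ps A D)) \<longlongrightarrow> 0) ?F"
    using ps(1)
  proof (induction ps)
    case Nil
    have "?d [] A D = (\<lambda>B. 0)" for A D
      by (auto simp: tensor_trunc_def tensor_sum_Nil)
    then show ?case by (simp only: proj_norm_zero case_prod_unfold tendsto_const)
  next
    case (Cons p ps)
    obtain x y where p: "p = (x, y)" by force
    have xy: "x \<in> c0 C" "y \<in> c0 R" and ps: "ps \<in> lists (c0 C \<times> c0 R)" using Cons by (auto simp: p)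
    have d: "?d (p # ps) A D = (\<lambda>B. ?d [(x, y)] A D B + ?d ps A D B)" for A D
      using tensor_sum_append[of C R "[p]" ps] by (auto simp: p tensor_trunc_def)
    have alg: "?d qs A D \<in> alg_tensor C R" if "qs \<in> lists (c0 C \<times> c0 R)" for qs A D
      using that by (intro alg_tensor_diff tensor_trunc_in_alg_tensor tensor_sum_in_alg_tensor)
    have xyl: "[(x, y)] \<in> lists (c0 C \<times> c0 R)" using xy by simp
    show ?case
    proof (rule tendsto_sandwich)
      have "p # ps \<in> lists (c0 C \<times> c0 R)" using Cons.hyps by simp
      from alg[OF this]
      show "\<forall>\<^sub>F q in ?F. 0 \<le> (case q of (A, D) \<Rightarrow> proj_norm C R (?d (p # ps) A D))"
        by (auto intro!: always_eventually proj_norm_nonneg)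
      show "\<forall>\<^sub>F q in ?F. (case q of (A, D) \<Rightarrow> proj_norm C R (?d (p # ps) A D))
          \<le> (case q of (A, D) \<Rightarrow> proj_norm C R (?d [(x, y)] A D) + proj_norm C R (?d ps A D))"
        unfolding d by (auto intro!: always_eventually proj_norm_add_le alg[OF xyl] alg[OF ps])
      show "((\<lambda>(A, D). proj_norm C R (?d [(x, y)] A D) + proj_norm C R (?d ps A D)) \<longlongrightarrow> 0) ?F"
        using tendsto_add_zero[OF tensor_trunc_elementary_tendsto[OF xy] Cons.IH] ps
        by (simp add: case_prod_unfold)
    qed simp
  qed
  then show ?thesis by (simp add: ps(2))
qed

text \<open>Turns the limit into one finite grid: the product filter is proper, and finiteness and
  inclusion hold eventually along it.\<close>

lemma tensor_trunc_approx:
  assumes "u \<in> alg_tensor C R" "e > 0"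
  obtains A D where "finite A" "A \<subseteq> C" "finite D" "D \<subseteq> R"
    "proj_norm C R (\<lambda>B. u B - tensor_trunc C R A D u B) < e"
proof -
  let ?F = "finite_subsets_at_top C \<times>\<^sub>F finite_subsets_at_top R"
  have "\<forall>\<^sub>F p in ?F. proj_norm C R (\<lambda>B. u B - tensor_trunc C R (fst p) (snd p) u B) < e"
    using order_tendstoD(2)[OF tensor_trunc_tendsto[OF assms(1)] assms(2)]
    by (simp add: case_prod_unfold)
  moreover have "\<forall>\<^sub>F p in ?F. finite (fst p) \<and> fst p \<subseteq> C"
    by (rule eventually_compose_filterlim[OF eventually_finite_subsets_at_top_weakI filterlim_fst]) simp
  moreover have "\<forall>\<^sub>F p in ?F. finite (snd p) \<and> snd p \<subseteq> R"
    by (rule eventually_compose_filterlim[OF eventually_finite_subsets_at_top_weakI filterlim_snd]) simp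
  ultimately have "\<forall>\<^sub>F p in ?F. (finite (fst p) \<and> fst p \<subseteq> C) \<and> (finite (snd p) \<and> snd p \<subseteq> R) \<and>
      proj_norm C R (\<lambda>B. u B - tensor_trunc C R (fst p) (snd p) u B) < e"
    by (simp add: eventually_conj_iff)
  moreover have "?F \<noteq> bot" by (simp add: prod_filter_eq_bot)
  ultimately obtain p where "(finite (fst p) \<and> fst p \<subseteq> C) \<and> (finite (snd p) \<and> snd p \<subseteq> R) \<and>
      proj_norm C R (\<lambda>B. u B - tensor_trunc C R (fst p) (snd p) u B) < e"
    using eventually_happens by blast
  with that show ?thesis by blast
qed

section \<open>Elements of the completion and their representatives\<close>

lemma proj_tensor_Cauchy:
  "u \<in> proj_tensor C R \<Longrightarrow> U \<in> u \<Longrightarrow> U \<in> tensor_Cauchy C R"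
  by (auto simp: proj_tensor_def quotient_def tensor_rel_def)

lemma tensor_Cauchy_alg: "U \<in> tensor_Cauchy C R \<Longrightarrow> U n \<in> alg_tensor C R"
  by (simp add: tensor_Cauchy_def)

lemma tensor_CauchyD:
  assumes "U \<in> tensor_Cauchy C R" "e > 0"
  obtains N where "\<And>m n. m \<ge> N \<Longrightarrow> n \<ge> N \<Longrightarrow> proj_norm C R (\<lambda>B. U m B - U n B) < e"
  using assms unfolding tensor_Cauchy_def by blast

lemma tensor_Cauchy_rel_refl:
  "U \<in> tensor_Cauchy C R \<Longrightarrow> (U, U) \<in> tensor_rel C R"
  by (simp add: tensor_rel_def proj_norm_zero)

lemma proj_tensor_class:
  assumes "U \<in> tensor_Cauchy C R"
  shows "tensor_rel C R `` {U} \<in> proj_tensor C R" "U \<in> tensor_rel C R `` {U}"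
  using assms by (auto simp: proj_tensor_def tensor_Cauchy_rel_refl intro: quotientI)

lemma proj_tensor_nonempty:
  assumes "u \<in> proj_tensor C R"
  obtains U where "U \<in> u"
  using assms by (auto simp: proj_tensor_def quotient_def dest: tensor_Cauchy_rel_refl)

text \<open>Membership in a class only compares \<open>U\<close> and \<open>V\<close> with a common
  representative \<open>W\<close>; symmetry and the triangle inequality then compare them with each
  other.\<close>

lemma proj_tensor_diff_tendsto:
  assumes "u \<in> proj_tensor C R" "U \<in> u" "V \<in> u"
  shows "(\<lambda>n. proj_norm C R (\<lambda>B. U n B - V n B)) \<longlonglongrightarrow> 0"
proof -
  obtain W where W: "u = tensor_rel C R `` {W}"
    using assms(1) by (auto simp: proj_tensor_def quotient_def)
  have alg: "U n \<in> alg_tensor C R" "V n \<in> alg_tensor C R" "W n \<in> alg_tensor C R" for n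
    using assms by (auto simp: W tensor_rel_def intro: tensor_Cauchy_alg)
  have WU: "(\<lambda>n. proj_norm C R (\<lambda>B. U n B - W n B)) \<longlonglongrightarrow> 0"
    using assms(2) by (subst proj_norm_minus_commute[OF alg(1,3)]) (auto simp: W tensor_rel_def)
  have WV: "(\<lambda>n. proj_norm C R (\<lambda>B. W n B - V n B)) \<longlonglongrightarrow> 0"
    using assms(3) by (auto simp: W tensor_rel_def)
  show ?thesis
  proof (rule tendsto_sandwich[OF _ _ tendsto_const tendsto_add_zero[OF WU WV]])
    show "\<forall>\<^sub>F n in sequentially. 0 \<le> proj_norm C R (\<lambda>B. U n B - V n B)"
      by (auto intro!: always_eventually proj_norm_nonneg alg_tensor_diff alg)
    show "\<forall>\<^sub>F n in sequentially. proj_norm C R (\<lambda>B. U n B - V n B)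
      \<le> proj_norm C R (\<lambda>B. U n B - W n B) + proj_norm C R (\<lambda>B. W n B - V n B)"
      by (auto intro!: always_eventually proj_norm_triangle alg)
  qed
qed

lemma abs_proj_norm_diff_le:
  assumes "u \<in> alg_tensor C R" "v \<in> alg_tensor C R"
  shows "\<bar>proj_norm C R u - proj_norm C R v\<bar> \<le> proj_norm C R (\<lambda>B. u B - v B)"
  using proj_norm_le_diff[OF assms] proj_norm_le_diff[OF assms(2,1)]
    proj_norm_minus_commute[OF assms] by linarith

text \<open>A limit along one representative is the limit along all of them, which justifies the
  definite description in \<open>proj_tensor_norm\<close>.\<close>

lemma proj_tensor_norm_eqI:
  assumes u: "u \<in> proj_tensor C R" and U: "U \<in> u" and l: "(\<lambda>n. proj_norm C R (U n)) \<longlonglongrightarrow> l"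
  shows "proj_tensor_norm C R u = l"
  unfolding proj_tensor_norm_def
proof (rule the_equality)
  show "\<forall>V\<in>u. (\<lambda>n. proj_norm C R (V n)) \<longlonglongrightarrow> l"
  proof
    fix V assume V: "V \<in> u"
    have "(\<lambda>n. proj_norm C R (V n) - proj_norm C R (U n)) \<longlonglongrightarrow> 0"
    proof (rule Lim_null_comparison[OF _ proj_tensor_diff_tendsto[OF u V U]])
      show "\<forall>\<^sub>F n in sequentially. norm (proj_norm C R (V n) - proj_norm C R (U n))
        \<le> proj_norm C R (\<lambda>B. V n B - U n B)"
        using u U V
        by (auto intro!: always_eventually abs_proj_norm_diff_le tensor_Cauchy_alg proj_tensor_Cauchy)
    qed
    from tendsto_add[OF this l] show "(\<lambda>n. proj_norm C R (V n)) \<longlonglongrightarrow> l" by simp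
  qed
  show "l' = l" if "\<forall>V\<in>u. (\<lambda>n. proj_norm C R (V n)) \<longlonglongrightarrow> l'" for l'
    using that U l LIMSEQ_unique by blast
qed

lemma proj_tensor_norm_tendsto:
  assumes u: "u \<in> proj_tensor C R" and U: "U \<in> u"
  shows "(\<lambda>n. proj_norm C R (U n)) \<longlonglongrightarrow> proj_tensor_norm C R u"
proof -
  have cau: "U \<in> tensor_Cauchy C R" by (rule proj_tensor_Cauchy[OF u U])
  have "Cauchy (\<lambda>n. proj_norm C R (U n))"
  proof (rule CauchyI)
    fix e :: real assume "e > 0"
    with cau obtain N where "\<And>m n. m \<ge> N \<Longrightarrow> n \<ge> N \<Longrightarrow> proj_norm C R (\<lambda>B. U m B - U n B) < e"
      by (rule tensor_CauchyD) blast
    then show "\<exists>N. \<forall>m\<ge>N. \<forall>n\<ge>N. norm (proj_norm C R (U m) - proj_norm C R (U n)) < e"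
      using order_le_less_trans[OF
        abs_proj_norm_diff_le[OF tensor_Cauchy_alg[OF cau] tensor_Cauchy_alg[OF cau]]]
      unfolding real_norm_def by blast
  qed
  then obtain l where "(\<lambda>n. proj_norm C R (U n)) \<longlonglongrightarrow> l"
    using Cauchy_convergent convergent_def by blast
  with proj_tensor_norm_eqI[OF u U this] show ?thesis by simp
qed

lemma tensor_coeff_eqI:
  assumes u: "u \<in> proj_tensor C R" and U: "U \<in> u" and l: "(\<lambda>n. U n (coeff_form c r)) \<longlonglongrightarrow> l"
  shows "tensor_coeff u r c = l"
  unfolding tensor_coeff_def coeff_form_def[symmetric]
proof (rule the_equality)
  show "\<forall>V\<in>u. (\<lambda>n. V n (coeff_form c r)) \<longlonglongrightarrow> l"
  proof
    fix V assume V: "V \<in> u"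
    have "(\<lambda>n. V n (coeff_form c r) - U n (coeff_form c r)) \<longlonglongrightarrow> 0"
    proof (rule Lim_null_comparison[OF _ proj_tensor_diff_tendsto[OF u V U]])
      show "\<forall>\<^sub>F n in sequentially. norm (V n (coeff_form c r) - U n (coeff_form c r))
        \<le> proj_norm C R (\<lambda>B. V n B - U n B)"
      proof (rule always_eventually, rule allI)
        fix n
        have "(\<lambda>B. V n B - U n B) \<in> alg_tensor C R"
          using u U V by (intro alg_tensor_diff tensor_Cauchy_alg proj_tensor_Cauchy)
        from norm_coeff_le_proj_norm[OF this, of c r]
        show "norm (V n (coeff_form c r) - U n (coeff_form c r)) \<le> proj_norm C R (\<lambda>B. V n B - U n B)" .
      qed
    qed
    from tendsto_add[OF this l] show "(\<lambda>n. V n (coeff_form c r)) \<longlonglongrightarrow> l" by simp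
  qed
  show "l' = l" if "\<forall>V\<in>u. (\<lambda>n. V n (coeff_form c r)) \<longlonglongrightarrow> l'" for l'
    using that U l LIMSEQ_unique by blast
qed

text \<open>Contractivity makes the coefficients along \<open>U\<close> a Cauchy sequence, and
  completeness of the scalars supplies the limit.\<close>

lemma tensor_coeff_tendsto:
  fixes u :: "(nat \<Rightarrow> ('i, 'j, 'k::{real_normed_field, banach}) form2 \<Rightarrow> 'k) set"
  assumes u: "u \<in> proj_tensor C R" and U: "U \<in> u"
  shows "(\<lambda>n. U n (coeff_form c r)) \<longlonglongrightarrow> tensor_coeff u r c"
proof -
  have cau: "U \<in> tensor_Cauchy C R" by (rule proj_tensor_Cauchy[OF u U])
  have "Cauchy (\<lambda>n. U n (coeff_form c r))"
  proof (rule CauchyI)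
    fix e :: real assume "e > 0"
    with cau obtain N where N: "\<And>m n. m \<ge> N \<Longrightarrow> n \<ge> N \<Longrightarrow> proj_norm C R (\<lambda>B. U m B - U n B) < e"
      by (rule tensor_CauchyD) blast
    have "norm (U m (coeff_form c r) - U n (coeff_form c r)) < e" if "m \<ge> N" "n \<ge> N" for m n
      using norm_coeff_le_proj_norm[OF alg_tensor_diff[OF tensor_Cauchy_alg[OF cau, of m]
          tensor_Cauchy_alg[OF cau, of n]], of c r] N[OF that] by simp
    then show "\<exists>N. \<forall>m\<ge>N. \<forall>n\<ge>N. norm (U m (coeff_form c r) - U n (coeff_form c r)) < e" by blast
  qed
  then obtain l where "(\<lambda>n. U n (coeff_form c r)) \<longlonglongrightarrow> l"
    using Cauchy_convergent convergent_def by blast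
  with tensor_coeff_eqI[OF u U this] show ?thesis by simp
qed

subsection \<open>Tensors supported on disjoint stars\<close>

text \<open>
  In the induction step, \<open>x\<^sub>0 \<otimes> y\<^sub>0 + x\<^sub>k \<otimes> y\<^sub>k\<close> is the mean of
  \<open>(x\<^sub>0 + x\<^sub>k) \<otimes> (y\<^sub>0 + y\<^sub>k)\<close> and \<open>(x\<^sub>0 - x\<^sub>k) \<otimes> (y\<^sub>0 - y\<^sub>k)\<close>, and disjointness of the
  supports keeps the sup norms of the factors below \<open>M\<^sub>1\<close> and \<open>M\<^sub>2\<close>.
\<close>

lemma proj_norm_disjoint_sum_le:
  fixes x :: "'b \<Rightarrow> 'i \<Rightarrow> 'k::real_normed_field" and y :: "'b \<Rightarrow> 'j \<Rightarrow> 'k"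
  assumes "finite J" and "disjoint_family_on X J" and "disjoint_family_on Y J"
    and "\<And>j. j \<in> J \<Longrightarrow> x j \<in> c0 C" and "\<And>j. j \<in> J \<Longrightarrow> y j \<in> c0 R"
    and "\<And>i j. j \<in> J \<Longrightarrow> i \<notin> X j \<Longrightarrow> x j i = 0" and "\<And>i j. j \<in> J \<Longrightarrow> i \<notin> Y j \<Longrightarrow> y j i = 0"
    and "\<And>i j. j \<in> J \<Longrightarrow> norm (x j i) \<le> M1" and "\<And>i j. j \<in> J \<Longrightarrow> norm (y j i) \<le> M2"
    and "x0 \<in> c0 C" and "y0 \<in> c0 R"
    and "\<And>i j. j \<in> J \<Longrightarrow> i \<in> X j \<Longrightarrow> x0 i = 0" and "\<And>i j. j \<in> J \<Longrightarrow> i \<in> Y j \<Longrightarrow> y0 i = 0"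
    and "\<And>i. norm (x0 i) \<le> M1" and "\<And>i. norm (y0 i) \<le> M2"
  shows "proj_norm C R (\<lambda>B. tensor_sum C R [(x0, y0)] B + (\<Sum>j\<in>J. tensor_sum C R [(x j, y j)] B))
    \<le> M1 * M2"
  using assms
proof (induction J arbitrary: x0 y0 rule: finite_induct)
  case empty
  have "proj_norm C R (tensor_sum C R [(x0, y0)]) \<le> sup_norm x0 * sup_norm y0"
    using empty by (intro proj_norm_elementary_le)
  also have "\<dots> \<le> M1 * M2"
  proof (rule mult_mono)
    show "0 \<le> M1" by (rule order_trans[OF norm_ge_zero empty.prems(13)])
  qed (use empty.prems in \<open>auto intro: sup_norm_le sup_norm_nonneg\<close>)
  finally show ?case by simp
next
  case (insert k J)
  note prems = insert.prems
  let ?E = "\<lambda>x y. tensor_sum C R [(x, y)]"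
  let ?S = "\<lambda>B. \<Sum>j\<in>J. ?E (x j) (y j) B"
  let ?p = "\<lambda>B. ?E (\<lambda>i. x0 i + x k i) (\<lambda>i. y0 i + y k i) B + ?S B"
  let ?m = "\<lambda>B. ?E (\<lambda>i. x0 i - x k i) (\<lambda>i. y0 i - y k i) B + ?S B"
  have k: "x k \<in> c0 C" "y k \<in> c0 R" using prems by auto
  note x0 = \<open>x0 \<in> c0 C\<close> and y0 = \<open>y0 \<in> c0 R\<close>
  have dX: "disjoint_family_on X J" and dY: "disjoint_family_on Y J"
    using prems(1,2) by (blast intro: disjoint_family_on_mono[OF subset_insertI])+
  \<comment> \<open>The induction hypothesis will be applied to the accumulated vectors
    \<open>x0 + x k\<close> and \<open>x0 - x k\<close>, which must vanish on the supports of the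
    remaining blocks.\<close>
  have X0: "x0 i = 0" "x k i = 0" if "j \<in> J" "i \<in> X j" for i j
  proof -
    have "j \<noteq> k" using that insert.hyps by blast
    then have "i \<notin> X k" using disjoint_family_onD[OF prems(1), of j k] that by auto
    then show "x k i = 0" by (intro prems(5)) simp
    show "x0 i = 0" using that by (intro prems(11)[of j]) simp_all
  qed
  have Y0: "y0 i = 0" "y k i = 0" if "j \<in> J" "i \<in> Y j" for i j
  proof -
    have "j \<noteq> k" using that insert.hyps by blast
    then have "i \<notin> Y k" using disjoint_family_onD[OF prems(2), of j k] that by auto
    then show "y k i = 0" by (intro prems(6)) simp
    show "y0 i = 0" using that by (intro prems(12)[of j]) simp_all
  qed
  have Mx: "norm (x0 i + x k i) \<le> M1" "norm (x0 i - x k i) \<le> M1" for i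
    using prems(5)[of k i] prems(7)[of k i] prems(11)[of k i] prems(13)[of i]
    by (cases "i \<in> X k"; simp)+
  have My: "norm (y0 i + y k i) \<le> M2" "norm (y0 i - y k i) \<le> M2" for i
    using prems(6)[of k i] prems(8)[of k i] prems(12)[of k i] prems(14)[of i]
    by (cases "i \<in> Y k"; simp)+
  have p: "proj_norm C R ?p \<le> M1 * M2"
    by (rule insert.IH[OF dX dY])
       (simp_all add: prems(3-8) Mx My c0_add[OF x0 k(1)] c0_add[OF y0 k(2)] X0 Y0)
  have m: "proj_norm C R ?m \<le> M1 * M2"
    by (rule insert.IH[OF dX dY])
       (simp_all add: prems(3-8) Mx My c0_diff[OF x0 k(1)] c0_diff[OF y0 k(2)] X0 Y0)
  have S: "?S \<in> alg_tensor C R"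
    using prems(3,4) insert.hyps by (intro alg_tensor_sum elementary_in_alg_tensor) auto
  have alg: "?p \<in> alg_tensor C R" "?m \<in> alg_tensor C R"
    by (rule alg_tensor_add[OF elementary_in_alg_tensor S];
        rule c0_add[OF x0 k(1)] c0_add[OF y0 k(2)] c0_diff[OF x0 k(1)] c0_diff[OF y0 k(2)])+
  have "?E x0 y0 B + (\<Sum>j\<in>insert k J. ?E (x j) (y j) B) = 1 / 2 * ?p B + 1 / 2 * ?m B" for B
  proof (cases "B \<in> bilinear_forms C R")
    case True
    have "?p B + ?m B = 2 * (?E x0 y0 B + (?E (x k) (y k) B + ?S B))"
      using True
      by (simp add: tensor_sum_def x0 y0 k c0_add c0_diff algebra_simps
          bilinear_form_add_left[OF True] bilinear_form_add_right[OF True]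
          bilinear_form_diff_left[OF True] bilinear_form_diff_right[OF True])
    then have "1 / 2 * ?p B + 1 / 2 * ?m B = 1 / 2 * (2 * (?E x0 y0 B + (?E (x k) (y k) B + ?S B)))"
      by (simp only: distrib_left[symmetric])
    also have "\<dots> = ?E x0 y0 B + (?E (x k) (y k) B + ?S B)" by simp
    finally show ?thesis by (simp only: sum.insert[OF insert.hyps])
  qed (simp add: tensor_sum_def)
  then have "proj_norm C R (\<lambda>B. ?E x0 y0 B + (\<Sum>j\<in>insert k J. ?E (x j) (y j) B))
      = proj_norm C R (\<lambda>B. 1 / 2 * ?p B + 1 / 2 * ?m B)" by (simp only:)
  also have "\<dots> \<le> norm (1 / 2 :: 'k) * proj_norm C R ?p + norm (1 / 2 :: 'k) * proj_norm C R ?m"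
    by (intro order_trans[OF proj_norm_add_le] add_mono proj_norm_mult_le alg_tensor_mult alg)
  also have "\<dots> \<le> M1 * M2"
    using p m by (simp add: norm_divide)
  finally show ?case .
qed

text \<open>Inside a star the tensor has rank one: a unit vector in one factor, the coefficients in
  the other. The bounds 1 on the left and \<open>M\<close> on the right are the same for all blocks,
  as \<open>proj_norm_disjoint_sum_le\<close> demands.\<close>

lemma star_block_elementary:
  fixes \<psi> :: "'j \<times> 'i \<Rightarrow> 'k::real_normed_field"
  assumes "finite P" "P \<subseteq> Y \<times> X" "X \<subseteq> C" "Y \<subseteq> R" "is_singleton Y \<or> is_singleton X"
    and M: "M > 0" and \<psi>: "\<And>q. q \<in> P \<Longrightarrow> norm (\<psi> q) \<le> M"
  obtains x y where "x \<in> c0 C" "y \<in> c0 R" "\<And>i. i \<notin> X \<Longrightarrow> x i = 0" "\<And>i. i \<notin> Y \<Longrightarrow> y i = 0"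
    "\<And>i. norm (x i) \<le> 1" "\<And>i. norm (y i) \<le> M" "coeff_tensor C R P \<psi> = tensor_sum C R [(x, y)]"
proof (cases "is_singleton X")
  case True
  then obtain c where c: "X = {c}" by (auto simp: is_singleton_def)
  define D where "D = fst ` P"
  define y where "y = (\<lambda>r. if (r, c) \<in> P then \<psi> (r, c) else 0)"
  have P: "P = (\<lambda>r. (r, c)) ` D" using assms(2) by (force simp: D_def c)
  have D: "finite D" "D \<subseteq> Y" "\<And>r. r \<notin> D \<Longrightarrow> y r = 0"
    using assms by (force simp: D_def y_def)+
  have uc: "unit_vec c \<in> c0 C" using assms c by (intro unit_vec_in_c0) auto
  have y: "y \<in> c0 R" using D assms by (intro c0_finite_support[of D]) auto
  have "coeff_tensor C R P \<psi> = tensor_sum C R [(unit_vec c, y)]"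
  proof
    fix B :: "('i, 'j, 'k) form2"
    have "(\<Sum>(r, c)\<in>P. \<psi> (r, c) * B (unit_vec c) (unit_vec r)) = B (unit_vec c) y"
      if B: "B \<in> bilinear_forms C R"
    proof -
      have "(\<Sum>(r, c)\<in>P. \<psi> (r, c) * B (unit_vec c) (unit_vec r))
          = (\<Sum>r\<in>D. \<psi> (r, c) * B (unit_vec c) (unit_vec r))"
        unfolding P by (subst sum.reindex) (auto simp: inj_on_def)
      also have "\<dots> = (\<Sum>r\<in>D. y r * B (unit_vec c) (unit_vec r))"
        by (intro sum.cong) (auto simp: y_def P)
      also have "\<dots> = B (unit_vec c) y"
        using D assms by (intro bilinear_form_expand_right[OF B uc, symmetric]) auto
      finally show ?thesis .
    qed
    then show "coeff_tensor C R P \<psi> B = tensor_sum C R [(unit_vec c, y)] B"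
      by (simp add: coeff_tensor_def tensor_sum_def)
  qed
  moreover have "norm (y r) \<le> M" for r using \<psi> M by (auto simp: y_def)
  moreover have "y r = 0" if "r \<notin> Y" for r using that D by blast
  ultimately show ?thesis
    using uc y by (intro that[of "unit_vec c" y]) (auto simp: unit_vec_def c)
next
  case False
  then obtain r where r: "Y = {r}" using assms by (auto simp: is_singleton_def)
  define D where "D = snd ` P"
  \<comment> \<open>In a row the coefficients form the left factor, whose bound is 1; they are
    divided by \<open>M\<close>, and \<open>M\<close> moves to the unit vector on the right.\<close>
  define x where "x = (\<lambda>c. if (r, c) \<in> P then \<psi> (r, c) / of_real M else 0)"
  define y where "y = (\<lambda>i. of_real M * unit_vec r i :: 'k)"
  have P: "P = (\<lambda>c. (r, c)) ` D" using assms(2) by (force simp: D_def r)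
  have D: "finite D" "D \<subseteq> X" "\<And>c. c \<notin> D \<Longrightarrow> x c = 0"
    using assms by (force simp: D_def x_def)+
  have ur: "unit_vec r \<in> c0 R" using assms r by (intro unit_vec_in_c0) auto
  have y: "y \<in> c0 R" unfolding y_def by (rule c0_mult[OF ur])
  have x: "x \<in> c0 C" using D assms by (intro c0_finite_support[of D]) auto
  have "coeff_tensor C R P \<psi> = tensor_sum C R [(x, y)]"
  proof
    fix B :: "('i, 'j, 'k) form2"
    have "(\<Sum>(r, c)\<in>P. \<psi> (r, c) * B (unit_vec c) (unit_vec r)) = B x y"
      if B: "B \<in> bilinear_forms C R"
    proof -
      have "(\<Sum>(r, c)\<in>P. \<psi> (r, c) * B (unit_vec c) (unit_vec r))
          = (\<Sum>c\<in>D. \<psi> (r, c) * B (unit_vec c) (unit_vec r))"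
        unfolding P by (subst sum.reindex) (auto simp: inj_on_def)
      also have "\<dots> = (\<Sum>c\<in>D. x c * B (unit_vec c) y)"
      proof (rule sum.cong[OF refl])
        fix c assume c: "c \<in> D"
        then have "unit_vec c \<in> c0 C" using D assms by (intro unit_vec_in_c0) auto
        from bilinear_form_mult_right[OF B this ur]
        show "\<psi> (r, c) * B (unit_vec c) (unit_vec r) = x c * B (unit_vec c) y"
          using M c by (auto simp: y_def x_def P)
      qed
      also have "\<dots> = B x y"
        using D assms by (intro bilinear_form_expand_left[OF B y, symmetric]) auto
      finally show ?thesis .
    qed
    then show "coeff_tensor C R P \<psi> B = tensor_sum C R [(x, y)] B"
      by (simp add: coeff_tensor_def tensor_sum_def)
  qed
  moreover have "norm (x c) \<le> 1" for c using \<psi> M by (auto simp: x_def norm_divide divide_simps)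
  moreover have "x c = 0" if "c \<notin> X" for c using that D by blast
  moreover have "norm (y i) \<le> M" for i using M by (auto simp: y_def unit_vec_def norm_mult)
  ultimately show ?thesis
    using x y by (intro that[of x y]) (auto simp: unit_vec_def r y_def)
qed

text \<open>The finite set \<open>Q\<close> meets finitely many blocks. Its part in each of them is
  an elementary tensor, and the factors inherit disjoint supports from the blocks.\<close>

lemma proj_norm_coeff_tensor_blocks_le:
  fixes \<psi> :: "'j \<times> 'i \<Rightarrow> 'k::real_normed_field"
  assumes Q: "finite Q" "Q \<subseteq> (\<Union>j\<in>J. Y j \<times> X j)"
    and sub: "\<And>j. j \<in> J \<Longrightarrow> Y j \<subseteq> R \<and> X j \<subseteq> C"
    and disj: "disjoint_family_on Y J" "disjoint_family_on X J"
    and star: "\<And>j. j \<in> J \<Longrightarrow> is_singleton (Y j) \<or> is_singleton (X j)"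
    and M: "M > 0" and \<psi>: "\<And>q. q \<in> Q \<Longrightarrow> norm (\<psi> q) \<le> M"
  shows "proj_norm C R (coeff_tensor C R Q \<psi>) \<le> M"
proof -
  have "\<forall>q\<in>Q. \<exists>j. j \<in> J \<and> q \<in> Y j \<times> X j" using Q by blast
  then obtain f where f: "\<And>q. q \<in> Q \<Longrightarrow> f q \<in> J \<and> q \<in> Y (f q) \<times> X (f q)" by metis
  let ?P = "\<lambda>j. {q \<in> Q. f q = j}"
  let ?good = "\<lambda>j (x, y). x \<in> c0 C \<and> y \<in> c0 R \<and> (\<forall>i. i \<notin> X j \<longrightarrow> x i = 0) \<and>
    (\<forall>i. i \<notin> Y j \<longrightarrow> y i = 0) \<and> (\<forall>i. norm (x i) \<le> 1) \<and> (\<forall>i. norm (y i) \<le> M) \<and>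
    coeff_tensor C R (?P j) \<psi> = tensor_sum C R [(x, y)]"
  have "\<forall>j\<in>f ` Q. \<exists>p. ?good j p"
  proof
    fix j assume "j \<in> f ` Q"
    then have j: "j \<in> J" using f by blast
    have P: "finite (?P j)" "?P j \<subseteq> Y j \<times> X j" "\<And>q. q \<in> ?P j \<Longrightarrow> norm (\<psi> q) \<le> M"
      using Q(1) f by (simp, blast, simp add: \<psi>)
    obtain x y where "x \<in> c0 C" "y \<in> c0 R" "\<And>i. i \<notin> X j \<Longrightarrow> x i = 0" "\<And>i. i \<notin> Y j \<Longrightarrow> y i = 0"
      "\<And>i. norm (x i) \<le> 1" "\<And>i. norm (y i) \<le> M" "coeff_tensor C R (?P j) \<psi> = tensor_sum C R [(x, y)]"
      by (rule star_block_elementary[where \<psi> = \<psi>, OF P(1,2) conjunct2[OF sub[OF j]] conjunct1[OF sub[OF j]]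
            star[OF j] M]) (rule P(3), assumption, rule that)
    then have "?good j (x, y)" by simp
    then show "\<exists>p. ?good j p" by (rule exI[of _ "(x, y)"])
  qed
  from bchoice[OF this] obtain g where "\<forall>j\<in>f ` Q. ?good j (g j)" ..
  then have g: "?good j (g j)" if "j \<in> f ` Q" for j using that by (rule bspec)
  define x where "x j = fst (g j)" for j
  define y where "y j = snd (g j)" for j
  have g: "?good j (x j, y j)" if "j \<in> f ` Q" for j
    using g[OF that] by (simp add: x_def y_def case_prod_unfold)
  have gx: "x j \<in> c0 C" "norm (x j i) \<le> 1" "i \<notin> X j \<Longrightarrow> x j i = 0"
    and gy: "y j \<in> c0 R" "norm (y j r) \<le> M" "r \<notin> Y j \<Longrightarrow> y j r = 0"
    if "j \<in> f ` Q" for j i r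
    using g[OF that] by simp_all
  have fJ: "f ` Q \<subseteq> J" using f by blast
  \<comment> \<open>The accumulated pair of \<open>proj_norm_disjoint_sum_le\<close> starts at zero
    and contributes the zero tensor.\<close>
  let ?z = "\<lambda>_. 0 :: 'k"
  have "coeff_tensor C R Q \<psi> =
      (\<lambda>B. tensor_sum C R [(?z, ?z)] B + (\<Sum>j\<in>f ` Q. tensor_sum C R [(x j, y j)] B))"
  proof
    fix B :: "('i, 'j, 'k) form2"
    have "coeff_tensor C R Q \<psi> B = (\<Sum>j\<in>f ` Q. coeff_tensor C R (?P j) \<psi> B)"
      unfolding coeff_tensor_def using Q(1) by (auto intro: sum.image_gen)
    also have "\<dots> = (\<Sum>j\<in>f ` Q. tensor_sum C R [(x j, y j)] B)"
      using g by (intro sum.cong) auto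
    also have "tensor_sum C R [(?z, ?z)] B = 0"
    proof (cases "B \<in> bilinear_forms C R")
      case True
      from bilinear_form_expand_left[OF True, of ?z "{}" ?z]
      show ?thesis by (simp add: tensor_sum_def c0_finite_support[of "{}"])
    qed (simp add: tensor_sum_def)
    ultimately show "coeff_tensor C R Q \<psi> B =
        tensor_sum C R [(?z, ?z)] B + (\<Sum>j\<in>f ` Q. tensor_sum C R [(x j, y j)] B)" by simp
  qed
  moreover have "proj_norm C R
      (\<lambda>B. tensor_sum C R [(?z, ?z)] B + (\<Sum>j\<in>f ` Q. tensor_sum C R [(x j, y j)] B)) \<le> 1 * M"
  proof (rule proj_norm_disjoint_sum_le[where X = X and Y = Y])
    show "disjoint_family_on X (f ` Q)" "disjoint_family_on Y (f ` Q)"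
      using disj by (blast intro: disjoint_family_on_mono[OF fJ])+
    show "?z \<in> c0 C" "?z \<in> c0 R" by (rule c0_finite_support[of "{}"]; simp)+
  qed (erule gx gy | assumption | simp add: Q(1) M less_imp_le)+
  ultimately show ?thesis by simp
qed

text \<open>The assumption \<open>bound\<close> is all that the stars contribute; existence and norm
  of the tensor follow from it by limits.\<close>

context
  fixes R C :: "'v set" and I :: "('v \<times> 'v) set" and \<phi> :: "'v \<times> 'v \<Rightarrow> 'k::{real_normed_field, banach}"
  assumes I: "I \<subseteq> R \<times> C" and \<phi>: "\<phi> \<in> c0 I"
    and bound: "\<And>Q (\<psi> :: 'v \<times> 'v \<Rightarrow> 'k) M. finite Q \<Longrightarrow> Q \<subseteq> I \<Longrightarrow> M > 0 \<Longrightarrow>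
      (\<And>q. q \<in> Q \<Longrightarrow> norm (\<psi> q) \<le> M) \<Longrightarrow> proj_norm C R (coeff_tensor C R Q \<psi>) \<le> M"
begin

text \<open>The level sets of \<phi> are finite and exhaust its support. Differences of the
  corresponding finite tensors have small coefficients, hence small norm by \<open>bound\<close>, so
  these tensors form a Cauchy sequence.\<close>

lemma tensor_with_coeffs_exists: "\<exists>u. tensor_with_coeffs C R I \<phi> u"
proof -
  define F where "F n = {q. inverse (Suc n) \<le> norm (\<phi> q)}" for n
  define U where "U n = coeff_tensor C R (F n) \<phi>" for n
  have F: "finite (F n)" for n
    unfolding F_def by (intro finite_c0_large[OF \<phi>]) simp
  have FI: "F n \<subseteq> I" for n
  proof
    fix q assume "q \<in> F n"
    then have "\<phi> q \<noteq> 0" by (auto simp: F_def)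
    then show "q \<in> I" using c0_vanishes[OF \<phi>] by blast
  qed
  have alg: "U n \<in> alg_tensor C R" for n
    unfolding U_def using F FI I by (intro coeff_tensor_in_alg_tensor) auto
  have diff: "proj_norm C R (\<lambda>B. U m B - U n B) \<le> inverse (Suc N)" if "m \<ge> N" "n \<ge> N" for m n N
  proof -
    \<comment> \<open>Points in both level sets cancel; a point in exactly one of them has a
      coefficient below the threshold of the other, hence at most \<open>inverse (Suc N)\<close> in
      norm.\<close>
    define \<psi> where "\<psi> q = (if q \<in> F m then \<phi> q else 0) - (if q \<in> F n then \<phi> q else 0)" for q
    have "U m B - U n B = coeff_tensor C R (F m \<union> F n) \<psi> B" for B
    proof -
      have "(\<Sum>(r, c)\<in>F k. \<phi> (r, c) * B (unit_vec c) (unit_vec r)) =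
          (\<Sum>(r, c)\<in>F m \<union> F n. (if (r, c) \<in> F k then \<phi> (r, c) else 0) * B (unit_vec c) (unit_vec r))"
        if "k \<in> {m, n}" for k
        using F that by (intro sum.mono_neutral_cong_left) auto
      then show ?thesis
        by (simp add: U_def coeff_tensor_def \<psi>_def left_diff_distrib case_prod_unfold sum_subtractf)
    qed
    moreover have "norm (\<psi> q) \<le> inverse (Suc N)" for q
    proof -
      have "norm (\<phi> q) \<le> inverse (Suc N)" if "q \<notin> F k" "k \<ge> N" for k
      proof -
        have "norm (\<phi> q) < inverse (Suc k)" using that(1) by (simp add: F_def)
        also have "\<dots> \<le> inverse (Suc N)" using that(2) by (intro le_imp_inverse_le) auto
        finally show ?thesis by simp
      qed
      from this[of m] this[of n] that show ?thesis by (simp add: \<psi>_def)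
    qed
    moreover have "F m \<union> F n \<subseteq> I" using FI[of m] FI[of n] by simp
    ultimately show ?thesis using F by (simp add: bound)
  qed
  have cau: "U \<in> tensor_Cauchy C R"
    unfolding tensor_Cauchy_def
  proof (intro CollectI conjI allI impI alg)
    fix e :: real assume "e > 0"
    then obtain N where "inverse (real (Suc N)) < e" using reals_Archimedean by blast
    then show "\<exists>N. \<forall>m\<ge>N. \<forall>n\<ge>N. proj_norm C R (\<lambda>B. U m B - U n B) < e"
      using diff order_le_less_trans by blast
  qed
  define u where "u = tensor_rel C R `` {U}"
  have u: "u \<in> proj_tensor C R" "U \<in> u"
    using proj_tensor_class[OF cau] by (simp_all add: u_def)
  have "tensor_coeff u r c = \<phi> (r, c)" for r c
  proof (rule tensor_coeff_eqI[OF u])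
    have "(\<lambda>n. U n (coeff_form c r) - \<phi> (r, c)) \<longlonglongrightarrow> 0"
      by (rule Lim_null_comparison[OF _ LIMSEQ_inverse_real_of_nat], rule always_eventually)
         (simp add: U_def coeff_tensor_coeff[OF F], simp add: F_def)
    then show "(\<lambda>n. U n (coeff_form c r)) \<longlonglongrightarrow> \<phi> (r, c)" by (simp add: LIM_zero_iff)
  qed
  then have "tensor_with_coeffs C R I \<phi> u"
    using u c0_vanishes[OF \<phi>] by (auto simp: tensor_with_coeffs_def)
  then show ?thesis ..
qed

text \<open>The lower bound is contractivity of the coefficients. For the upper bound, the terms of
  a representative may have coefficients off \<open>I\<close>, so \<open>bound\<close> is applied to
  \<phi> on a finite grid instead, to which truncated terms are close.\<close>

lemma proj_tensor_norm_with_coeffs: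
  assumes "tensor_with_coeffs C R I \<phi> u"
  shows "proj_tensor_norm C R u = sup_norm \<phi>"
proof -
  let ?n = "proj_norm C R" and ?s = "sup_norm \<phi>"
  have u: "u \<in> proj_tensor C R"
    and if_coeff: "\<forall>r\<in>R. \<forall>c\<in>C. tensor_coeff u r c = (if (r, c) \<in> I then \<phi> (r, c) else 0)"
    using assms by (simp_all add: tensor_with_coeffs_def)
  have coeff: "tensor_coeff u r c = \<phi> (r, c)" if "r \<in> R" "c \<in> C" for r c
    using if_coeff that c0_vanishes[OF \<phi>, of "(r, c)"] by simp
  have \<phi>_nonzero: "q \<in> I" if "\<phi> q \<noteq> 0" for q
    using that c0_vanishes[OF \<phi>, of q] by (rule contrapos_np)
  obtain U where U: "U \<in> u" using u by (rule proj_tensor_nonempty)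
  have cau: "U \<in> tensor_Cauchy C R" by (rule proj_tensor_Cauchy[OF u U])
  note alg = tensor_Cauchy_alg[OF cau]
  have lim: "(\<lambda>n. U n (coeff_form c r)) \<longlonglongrightarrow> \<phi> (r, c)" if "r \<in> R" "c \<in> C" for r c
    using tensor_coeff_tendsto[OF u U, of c r] coeff[OF that] by simp
  note norm_lim = proj_tensor_norm_tendsto[OF u U]
  have "norm (\<phi> q) \<le> proj_tensor_norm C R u" for q
  proof (cases "q \<in> I")
    case True
    then obtain r c where q: "q = (r, c)" "r \<in> R" "c \<in> C" using I by auto
    show ?thesis
      unfolding q(1)
    proof (rule LIMSEQ_le[OF tendsto_norm[OF lim[OF q(2,3)]] norm_lim])
      show "\<exists>N. \<forall>n\<ge>N. norm (U n (coeff_form c r)) \<le> ?n (U n)"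
        using norm_coeff_le_proj_norm[OF alg] by blast
    qed
  next
    case False
    have "0 \<le> proj_tensor_norm C R u"
      using LIMSEQ_le_const[OF norm_lim] proj_norm_nonneg[OF alg] by blast
    then show ?thesis using c0_vanishes[OF \<phi> False] by simp
  qed
  then have ge: "?s \<le> proj_tensor_norm C R u" by (rule sup_norm_le)
  \<comment> \<open>Order of choice: \<open>N\<close> from the Cauchy property, then a grid for
    \<open>U N\<close>, then \<open>m\<close> so late that \<open>U m\<close> has almost the
    coefficients of \<phi> on this grid. The five errors: \<open>U k\<close> to \<open>U N\<close>,
    \<open>U N\<close> to its truncation, that truncation to the one of \<open>U m\<close>, the
    coefficients on the grid, and the slack in \<open>bound\<close>.\<close>
  have "proj_tensor_norm C R u \<le> ?s + 5 * e" if e: "e > 0" for e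
  proof -
    obtain N where N: "\<And>m n. m \<ge> N \<Longrightarrow> n \<ge> N \<Longrightarrow> ?n (\<lambda>B. U m B - U n B) < e"
      using cau e by (rule tensor_CauchyD) blast
    obtain A D where A: "finite A" "A \<subseteq> C" and D: "finite D" "D \<subseteq> R"
      and AD: "?n (\<lambda>B. U N B - tensor_trunc C R A D (U N) B) < e"
      using alg e by (rule tensor_trunc_approx)
    let ?T = "tensor_trunc C R A D"
    let ?d = "\<lambda>m q. U m (coeff_form (snd q) (fst q)) - \<phi> q"
    have "(\<lambda>m. \<Sum>q\<in>D \<times> A. norm (?d m q)) \<longlonglongrightarrow> (\<Sum>q\<in>D \<times> A. 0)"
    proof (intro tendsto_sum tendsto_norm_zero LIM_zero)
      fix q assume "q \<in> D \<times> A"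
      then have "fst q \<in> D" "snd q \<in> A" by (simp_all add: mem_Times_iff)
      from lim[OF subsetD[OF D(2) this(1)] subsetD[OF A(2) this(2)]] show "(\<lambda>m. U m (coeff_form (snd q) (fst q))) \<longlonglongrightarrow> \<phi> q" by simp
    qed
    then have "\<forall>\<^sub>F m in sequentially. (\<Sum>q\<in>D \<times> A. norm (?d m q)) < e"
      using e by (intro order_tendstoD(2)[where a = e]) auto
    from eventually_happens'[OF _ eventually_conj[OF eventually_ge_at_top[of N] this]]
    obtain m where m: "m \<ge> N" "(\<Sum>q\<in>D \<times> A. norm (?d m q)) < e"
      by auto
    let ?Q = "D \<times> A \<inter> I"
    have DA: "finite (D \<times> A)" "D \<times> A \<subseteq> R \<times> C"
      using A D by (simp_all add: Sigma_mono)
    then have Q: "finite ?Q" "?Q \<subseteq> I" by simp_all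
    have algs: "coeff_tensor C R (D \<times> A) (?d m) \<in> alg_tensor C R" "coeff_tensor C R ?Q \<phi> \<in> alg_tensor C R"
      by (rule coeff_tensor_in_alg_tensor[OF DA])
         (rule coeff_tensor_in_alg_tensor[OF Q(1) order_trans[OF Q(2) I]])
    have "?T (U m) = (\<lambda>B. coeff_tensor C R (D \<times> A) (?d m) B + coeff_tensor C R ?Q \<phi> B)"
    proof
      fix B :: "('v, 'v, 'k) form2"
      have "(\<Sum>(r, c)\<in>?Q. \<phi> (r, c) * B (unit_vec c) (unit_vec r)) =
          (\<Sum>(r, c)\<in>D \<times> A. \<phi> (r, c) * B (unit_vec c) (unit_vec r))"
        by (rule sum.mono_neutral_left[OF DA(1)]) (auto dest: \<phi>_nonzero)
      then show "?T (U m) B = coeff_tensor C R (D \<times> A) (?d m) B + coeff_tensor C R ?Q \<phi> B"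
        unfolding tensor_trunc_eq_coeff_tensor[OF alg A D]
        by (simp add: coeff_tensor_def case_prod_unfold left_diff_distrib sum_subtractf)
    qed
    then have "?n (?T (U m)) \<le> ?n (coeff_tensor C R (D \<times> A) (?d m)) + ?n (coeff_tensor C R ?Q \<phi>)"
      using proj_norm_add_le[OF algs] by simp
    moreover have "?n (coeff_tensor C R (D \<times> A) (?d m)) < e"
      by (rule order_le_less_trans[OF proj_norm_coeff_tensor_le_sum[OF DA] m(2)])
    \<comment> \<open>The slack \<open>e\<close> keeps the bound positive, as \<open>bound\<close>
      requires, even for \<phi> = 0.\<close>
    moreover have "?n (coeff_tensor C R ?Q \<phi>) \<le> ?s + e"
    proof (rule bound[OF Q])
      show "?s + e > 0" using sup_norm_nonneg[OF \<phi>] e by simp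
      show "norm (\<phi> q) \<le> ?s + e" for q using norm_le_sup_norm[OF \<phi>, of q] e by simp
    qed
    ultimately have Tm: "?n (?T (U m)) \<le> ?s + 2 * e" by simp
    have T: "?T (U k) \<in> alg_tensor C R" for k by (rule tensor_trunc_in_alg_tensor[OF alg])
    have "?n (\<lambda>B. ?T (U N) B - ?T (U m) B) \<le> ?n (\<lambda>B. U N B - U m B)"
      using proj_norm_tensor_trunc_le[OF alg_tensor_diff[OF alg[of N] alg[of m]], of A D]
      by (simp add: tensor_trunc_diff)
    then have Nm: "?n (\<lambda>B. ?T (U N) B - ?T (U m) B) < e" using N[of N m] m(1) by simp
    have "?n (U k) \<le> ?s + 5 * e" if "k \<ge> N" for k
      using proj_norm_le_diff[OF alg alg, of k N] N[of k N] that
        proj_norm_le_diff[OF alg T, of N N] AD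
        proj_norm_le_diff[OF T T, of N m] Nm Tm by simp
    then show ?thesis using LIMSEQ_le_const2[OF norm_lim] by blast
  qed
  from this[of "e / 5" for e] have "proj_tensor_norm C R u \<le> ?s + e" if "e > 0" for e
    using that by simp
  then have "proj_tensor_norm C R u \<le> ?s" by (rule field_le_epsilon)
  with ge show ?thesis by simp
qed

end

subsection \<open>Paths of length three and decomposition into stars\<close>

text \<open>The parallelogram law bounds the sum of the squares of the two norms, and
  \<open>(p + q)^2\<close> is at most \<open>2 * (p^2 + q^2)\<close>. Over the complex numbers
  \<open>b = i * a\<close> with \<open>norm a = s\<close> gives equality.\<close>

lemma norm_add_plus_norm_diff_le:
  fixes a b :: "'a::real_inner"
  assumes "norm a \<le> s" "norm b \<le> s"
  shows "norm (a - b) + norm (a + b) \<le> 2 * sqrt 2 * s"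
proof -
  let ?p = "norm (a - b)" and ?q = "norm (a + b)"
  have s: "0 \<le> s" using assms(1) norm_ge_zero order_trans by blast
  have "?p\<^sup>2 + ?q\<^sup>2 = 2 * ((norm a)\<^sup>2 + (norm b)\<^sup>2)"
    by (simp add: power2_norm_eq_inner inner_diff inner_add inner_commute algebra_simps)
  also have "\<dots> \<le> 2 * (s\<^sup>2 + s\<^sup>2)"
    using assms by (intro mult_left_mono add_mono power_mono) auto
  finally have pq: "?p\<^sup>2 + ?q\<^sup>2 \<le> 2 * (s\<^sup>2 + s\<^sup>2)" .
  have "p + q \<le> 2 * sqrt 2 * s" if "p\<^sup>2 + q\<^sup>2 \<le> 2 * (s\<^sup>2 + s\<^sup>2)" for p q :: real
  proof (rule power2_le_imp_le)
    have "(p + q)\<^sup>2 \<le> (p\<^sup>2 + q\<^sup>2) + (p\<^sup>2 + q\<^sup>2)"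
      unfolding power2_sum by (rule add_left_mono[OF sum_squares_bound])
    also have "\<dots> \<le> 2 * (s\<^sup>2 + s\<^sup>2) + 2 * (s\<^sup>2 + s\<^sup>2)" by (rule add_mono[OF that that])
    also have "\<dots> = (2 * sqrt 2 * s)\<^sup>2" by (simp add: power_mult_distrib)
    finally show "(p + q)\<^sup>2 \<le> (2 * sqrt 2 * s)\<^sup>2" .
  qed (use s in simp)
  from this[OF pq] show ?thesis .
qed

text \<open>
  The form with matrix \<open>(1, -1; 1, 1)\<close> has norm at most \<open>2 * sqrt 2\<close>, over the reals as over the
  complex numbers, but takes the value \<open>3 > 2 * sqrt 2\<close> at a tensor with coefficients \<open>1\<close> at its
  three positive entries and \<open>0\<close> at the fourth.
\<close>

lemma isometry_imp_no_three_path: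
  fixes R C :: "'v set" and I :: "('v \<times> 'v) set"
  assumes I: "I \<subseteq> R \<times> C"
    and a: "\<forall>\<phi> \<in> (c0 I :: ('v \<times> 'v \<Rightarrow> 'k::{real_normed_field, euclidean_space}) set).
      (\<exists>u. tensor_with_coeffs C R I \<phi> u) \<and>
      (\<forall>u. tensor_with_coeffs C R I \<phi> u \<longrightarrow> proj_tensor_norm C R u = sup_norm \<phi>)"
    and edges: "(r, c) \<in> I" "(r', c) \<in> I" "(r', c') \<in> I"
  shows "r = r' \<or> c = c'"
proof (rule ccontr)
  assume "\<not> (r = r' \<or> c = c')"
  then have ne: "r \<noteq> r'" "c \<noteq> c'" by auto
  define P where "P = {(r, c), (r', c), (r', c')}"
  \<comment> \<open>The fourth corner \<open>(r, c')\<close> may belong to \<open>I\<close>; \<phi>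
    is 0 there in either case.\<close>
  define \<phi> :: "'v \<times> 'v \<Rightarrow> 'k" where "\<phi> q = (if q \<in> P then 1 else 0)" for q
  have "P \<subseteq> I" using edges by (simp add: P_def)
  then have \<phi>: "\<phi> \<in> c0 I" by (intro c0_finite_support[of P]) (auto simp: P_def \<phi>_def)
  obtain u where u: "tensor_with_coeffs C R I \<phi> u" and norm: "proj_tensor_norm C R u = sup_norm \<phi>"
    using a \<phi> by blast
  have "sup_norm \<phi> \<le> 1" by (rule sup_norm_le) (simp add: \<phi>_def)
  have ut: "u \<in> proj_tensor C R" using u by (simp add: tensor_with_coeffs_def)
  obtain U where U: "U \<in> u" using ut by (rule proj_tensor_nonempty)
  note alg = tensor_Cauchy_alg[OF proj_tensor_Cauchy[OF ut U]]
  have RC: "r \<in> R" "r' \<in> R" "c \<in> C" "c' \<in> C" using edges I by auto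
  have lim: "(\<lambda>n. U n (coeff_form j i)) \<longlonglongrightarrow> \<phi> (i, j)" if "i \<in> R" "j \<in> C" for i j
  proof -
    have "tensor_coeff u i j = \<phi> (i, j)"
      using u that c0_vanishes[OF \<phi>, of "(i, j)"] by (simp add: tensor_with_coeffs_def)
    with tensor_coeff_tendsto[OF ut U, of j i] show ?thesis by simp
  qed
  let ?B = "\<lambda>x y. (x c - x c') * y r + (x c + x c') * y r' :: 'k"
  have B: "?B \<in> bilinear_forms C R"
    by (simp add: bilinear_forms_def linear_form_on_def algebra_simps)
  have bound: "norm (?B x y) \<le> 2 * sqrt 2 * (sup_norm x * sup_norm y)"
    if x: "x \<in> c0 C" and y: "y \<in> c0 R" for x y
  proof -
    have "norm (?B x y) \<le> norm (x c - x c') * sup_norm y + norm (x c + x c') * sup_norm y"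
      unfolding norm_mult[symmetric]
      by (intro norm_triangle_le add_mono) (auto simp: norm_mult intro!: mult_left_mono norm_le_sup_norm[OF y])
    also have "\<dots> = (norm (x c - x c') + norm (x c + x c')) * sup_norm y"
      by (simp add: distrib_right)
    also have "\<dots> \<le> 2 * sqrt 2 * sup_norm x * sup_norm y"
      by (intro mult_right_mono norm_add_plus_norm_diff_le norm_le_sup_norm[OF x] sup_norm_nonneg[OF y])
    finally show ?thesis by (simp add: mult.assoc)
  qed
  \<comment> \<open>A tensor is merely a function on forms, so additivity in the form is read off a
    representation. It reduces the value at \<open>?B\<close> to four coefficients.\<close>
  have val: "v ?B = v (coeff_form c r) - v (coeff_form c' r) + v (coeff_form c r') + v (coeff_form c' r')"
    if v: "v \<in> alg_tensor C R" for v
  proof -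
    obtain ps where ps: "ps \<in> lists (c0 C \<times> c0 R)" "v = tensor_sum C R ps"
      using v by (rule alg_tensorE)
    have "(\<Sum>(x, y)\<leftarrow>ps. ?B x y) = (\<Sum>(x, y)\<leftarrow>ps. coeff_form c r x y) - (\<Sum>(x, y)\<leftarrow>ps. coeff_form c' r x y)
        + (\<Sum>(x, y)\<leftarrow>ps. coeff_form c r' x y) + (\<Sum>(x, y)\<leftarrow>ps. coeff_form c' r' x y)"
      by (induction ps) (auto simp: coeff_form_def algebra_simps)
    then show ?thesis by (simp add: ps(2) tensor_sum_def B coeff_form_bilinear)
  qed
  have "(\<lambda>n. U n ?B) \<longlonglongrightarrow> \<phi> (r, c) - \<phi> (r, c') + \<phi> (r', c) + \<phi> (r', c')"
    unfolding val[OF alg] by (intro tendsto_intros lim RC)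
  also have "\<phi> (r, c) - \<phi> (r, c') + \<phi> (r', c) + \<phi> (r', c') = 3"
    using ne by (simp add: \<phi>_def P_def)
  finally have lim3: "(\<lambda>n. norm (U n ?B)) \<longlonglongrightarrow> norm (3 :: 'k)" by (rule tendsto_norm)
  have "norm (3 :: 'k) \<le> 2 * sqrt 2 * proj_tensor_norm C R u"
  proof (rule LIMSEQ_le[OF lim3 tendsto_mult_left[OF proj_tensor_norm_tendsto[OF ut U]]])
    show "\<exists>N. \<forall>n\<ge>N. norm (U n ?B) \<le> 2 * sqrt 2 * proj_norm C R (U n)"
      using norm_apply_le_proj_norm[OF B alg _ bound] by simp
  qed
  also have "\<dots> \<le> 2 * sqrt 2 * 1"
    using \<open>sup_norm \<phi> \<le> 1\<close> norm by (intro mult_left_mono) auto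
  \<comment> \<open>Squared, the inequality reads 9 \<le> 8.\<close>
  finally have "3\<^sup>2 \<le> (2 * sqrt 2 :: real)\<^sup>2" by (intro power_mono) auto
  then show False by (simp add: power_mult_distrib)
qed

text \<open>By \<open>K\<close> no edge has both a second edge in its row and a second edge in its
  column, so the column through it times the row through it is a star. These stars are the
  blocks.\<close>

lemma star_decomposition:
  fixes I :: "('r \<times> 'c) set"
  assumes "countable I" and I: "I \<subseteq> R \<times> C"
    and K: "\<And>r r' c c'. (r, c) \<in> I \<Longrightarrow> (r', c) \<in> I \<Longrightarrow> (r', c') \<in> I \<Longrightarrow> r = r' \<or> c = c'"
  shows "\<exists>(J :: nat set) Rj Cj.
      (\<forall>j\<in>J. Rj j \<subseteq> R \<and> Cj j \<subseteq> C) \<and>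
      disjoint_family_on Rj J \<and> disjoint_family_on Cj J \<and>
      (\<forall>j\<in>J. is_singleton (Rj j) \<or> is_singleton (Cj j)) \<and>
      I = (\<Union>j\<in>J. Rj j \<times> Cj j)"
proof -
  define X where "X q = {r. (r, snd q) \<in> I}" for q :: "'r \<times> 'c"
  define Y where "Y q = {c. (fst q, c) \<in> I}" for q :: "'r \<times> 'c"
  define \<B> where "\<B> = (\<lambda>q. (X q, Y q)) ` I"
  have "countable \<B>" using assms(1) by (simp add: \<B>_def)
  \<comment> \<open>Numbering the blocks instead of the edges gives distinct indices distinct
    blocks; disjointness then means that blocks with a common vertex coincide.\<close>
  define Z where "Z = from_nat_into \<B>"
  define J where "J = to_nat_on \<B> ` \<B>"
  have ZJ: "Z ` J = \<B>" "inj_on Z J"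
    using \<open>countable \<B>\<close> by (auto simp: Z_def J_def image_image inj_on_def)
  have blk: "\<exists>r c. (r, c) \<in> I \<and> Z j = ({r'. (r', c) \<in> I}, {c'. (r, c') \<in> I})" if "j \<in> J" for j
  proof -
    have "Z j \<in> \<B>" using that ZJ by blast
    then obtain q where "q \<in> I" "Z j = (X q, Y q)" by (auto simp: \<B>_def)
    then show ?thesis
      by (intro exI[of _ "fst q"] exI[of _ "snd q"]) (simp add: X_def Y_def)
  qed
  have sing: "{r'. (r', c) \<in> I} = {r} \<or> {c'. (r, c') \<in> I} = {c}" if rc: "(r, c) \<in> I" for r c
  proof (rule ccontr)
    assume "\<not> ?thesis"
    then obtain r' c' where "(r', c) \<in> I" "r' \<noteq> r" "(r, c') \<in> I" "c' \<noteq> c" using rc by blast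
    with K[of r' c r c'] rc show False by blast
  qed
  have rows: "{r'. (r', c) \<in> I} = {r}" if "(r, c) \<in> I" "(r, c') \<in> I" "c' \<noteq> c" for r c c'
    using sing[OF that(1)] that by blast
  have cols: "{c'. (r, c') \<in> I} = {c}" if "(r, c) \<in> I" "(r', c) \<in> I" "r' \<noteq> r" for r r' c
    using sing[OF that(1)] that by blast
  have disj: "Z i = Z j" if ij: "i \<in> J" "j \<in> J" "fst (Z i) \<inter> fst (Z j) \<noteq> {} \<or> snd (Z i) \<inter> snd (Z j) \<noteq> {}" for i j
  proof -
    obtain r c where i: "(r, c) \<in> I" "Z i = ({r'. (r', c) \<in> I}, {c'. (r, c') \<in> I})"
      using blk[OF ij(1)] by blast
    obtain s d where j: "(s, d) \<in> I" "Z j = ({r'. (r', d) \<in> I}, {c'. (s, c') \<in> I})"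
      using blk[OF ij(2)] by blast
    \<comment> \<open>In case \<open>row\<close>, \<open>x\<close> is adjacent to \<open>c\<close>
      and \<open>d\<close>. If \<open>c = d\<close> and \<open>r\<close>, \<open>s\<close> differ,
      column \<open>c\<close> has two edges and both rows shrink to \<open>{c}\<close>. If
      \<open>c\<close> and \<open>d\<close> differ, row \<open>x\<close> has two edges, both columns
      shrink to \<open>{x}\<close>, and \<open>r = s = x\<close>. Case \<open>col\<close> is
      symmetric.\<close>
    from ij(3) consider (row) x where "(x, c) \<in> I" "(x, d) \<in> I" | (col) x where "(r, x) \<in> I" "(s, x) \<in> I"
      by (auto simp: i(2) j(2))
    then show ?thesis
    proof cases
      case row
      show ?thesis
      proof (cases "c = d")
        case True
        show ?thesis
        proof (cases "r = s")
          case False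
          with True i(1) j(1) have "{c'. (r, c') \<in> I} = {c}" "{c'. (s, c') \<in> I} = {c}"
            using cols[of r c s] cols[of s c r] by simp_all
          then show ?thesis by (simp only: i(2) j(2) True)
        qed (simp only: i(2) j(2) True)
      next
        case False
        then have xc: "{r'. (r', c) \<in> I} = {x}" and xd: "{r'. (r', d) \<in> I} = {x}"
          using rows[OF row] rows[OF row(2,1)] by simp_all
        then have "r = x" "s = x" using i(1) j(1) by blast+
        then show ?thesis by (simp only: i(2) j(2) xc xd)
      qed
    next
      case col
      show ?thesis
      proof (cases "r = s")
        case True
        show ?thesis
        proof (cases "c = d")
          case False
          with True i(1) j(1) have "{r'. (r', c) \<in> I} = {r}" "{r'. (r', d) \<in> I} = {r}"
            using rows[of r c d] rows[of r d c] by simp_all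
          then show ?thesis by (simp only: i(2) j(2) True)
        qed (simp only: i(2) j(2) True)
      next
        case False
        then have xr: "{c'. (r, c') \<in> I} = {x}" and xs: "{c'. (s, c') \<in> I} = {x}"
          using cols[OF col] cols[OF col(2,1)] by simp_all
        then have "c = x" "d = x" using i(1) j(1) by blast+
        then show ?thesis by (simp only: i(2) j(2) xr xs)
      qed
    qed
  qed
  show ?thesis
  proof (intro exI[of _ J] exI[of _ "fst \<circ> Z"] exI[of _ "snd \<circ> Z"] conjI ballI)
    show "disjoint_family_on (fst \<circ> Z) J" "disjoint_family_on (snd \<circ> Z) J"
      unfolding disjoint_family_on_def o_def using disj inj_onD[OF ZJ(2)] by meson+
  next
    fix j assume "j \<in> J"
    then obtain r c where j: "(r, c) \<in> I" "Z j = ({r'. (r', c) \<in> I}, {c'. (r, c') \<in> I})"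
      using blk by blast
    show "(fst \<circ> Z) j \<subseteq> R" "(snd \<circ> Z) j \<subseteq> C" using j I by auto
    show "is_singleton ((fst \<circ> Z) j) \<or> is_singleton ((snd \<circ> Z) j)"
      using sing[OF j(1)] by (elim disjE) (simp_all add: j(2))
  next
    show "I = (\<Union>j\<in>J. (fst \<circ> Z) j \<times> (snd \<circ> Z) j)"
    proof (intro equalityI subsetI)
      fix q assume q: "q \<in> I"
      then have "(X q, Y q) \<in> Z ` J" unfolding ZJ(1) \<B>_def by (rule imageI)
      then obtain j where "j \<in> J" "Z j = (X q, Y q)" by (elim imageE) simp
      moreover have "q \<in> X q \<times> Y q" using q by (cases q) (simp add: X_def Y_def)
      ultimately show "q \<in> (\<Union>j\<in>J. (fst \<circ> Z) j \<times> (snd \<circ> Z) j)"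
        by (intro UN_I[of j]) simp_all
    next
      fix q assume "q \<in> (\<Union>j\<in>J. (fst \<circ> Z) j \<times> (snd \<circ> Z) j)"
      then obtain j where "j \<in> J" and q: "q \<in> fst (Z j) \<times> snd (Z j)" by auto
      then obtain r c where j: "(r, c) \<in> I" "Z j = ({r'. (r', c) \<in> I}, {c'. (r, c') \<in> I})"
        using blk by blast
      obtain x y where "q = (x, y)" "(x, c) \<in> I" "(r, y) \<in> I" using q unfolding j(2) by auto
      \<comment> \<open>By \<open>K\<close> the point \<open>q\<close> shares a coordinate with
        \<open>(r, c)\<close>, so it is one of the two edges just obtained.\<close>
      moreover have "x = r \<or> y = c" using K[OF calculation(2) j(1) calculation(3)] by auto
      ultimately show "q \<in> I" by auto
    qed
  qed
qed

section \<open>Blocks as star graphs, and paths in them\<close>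

lemma graph_edges_image: "graph_edges I = (\<lambda>(r, c). {r, c}) ` I"
  by (auto simp: graph_edges_def image_def)

lemma graph_edges_star_left: "graph_edges ({r} \<times> X) = (\<lambda>w. {r, w}) ` X"
  by (force simp: graph_edges_image)

lemma graph_edges_star_right: "graph_edges (Y \<times> {c}) = (\<lambda>w. {c, w}) ` Y"
  unfolding insert_commute[of c] by (force simp: graph_edges_image)

text \<open>A block is a star centred at its singleton side. Disjointness of \<open>R\<close> and
  \<open>C\<close> keeps the centre off the leaves and prevents a row of one block from being a
  column of another.\<close>

lemma disjoint_stars_of_decomposition:
  fixes R C :: "'v set"
  assumes "R \<inter> C = {}"
    and sub: "\<And>j. j \<in> J \<Longrightarrow> Rj j \<subseteq> R \<and> Cj j \<subseteq> C"
    and disj: "disjoint_family_on Rj J" "disjoint_family_on Cj J"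
    and star: "\<And>j. j \<in> J \<Longrightarrow> is_singleton (Rj j) \<or> is_singleton (Cj j)"
  shows "union_of_disjoint_stars (graph_edges (\<Union>j\<in>J. Rj j \<times> Cj j))"
  unfolding union_of_disjoint_stars_def
proof (intro exI[of _ "(\<lambda>j. graph_edges (Rj j \<times> Cj j)) ` J"] conjI)
  show "\<forall>F\<in>(\<lambda>j. graph_edges (Rj j \<times> Cj j)) ` J. star_graph F"
  proof (intro ballI, elim imageE, hypsubst)
    fix j assume j: "j \<in> J"
    have RC: "Rj j \<inter> Cj j = {}" using sub[OF j] assms(1) by blast
    from star[OF j] show "star_graph (graph_edges (Rj j \<times> Cj j))"
    proof
      assume "is_singleton (Rj j)"
      then obtain r where "Rj j = {r}" by (auto simp: is_singleton_def)
      with RC have "r \<notin> Cj j" "graph_edges (Rj j \<times> Cj j) = (\<lambda>w. {r, w}) ` Cj j"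
        by (simp_all add: graph_edges_star_left)
      then show ?thesis unfolding star_graph_def by blast
    next
      assume "is_singleton (Cj j)"
      then obtain c where "Cj j = {c}" by (auto simp: is_singleton_def)
      with RC have "c \<notin> Rj j" "graph_edges (Rj j \<times> Cj j) = (\<lambda>w. {c, w}) ` Rj j"
        by (simp_all add: graph_edges_star_right)
      then show ?thesis unfolding star_graph_def by blast
    qed
  qed
  have V: "\<Union>(graph_edges (Rj j \<times> Cj j)) \<subseteq> Rj j \<union> Cj j" for j
    by (auto simp: graph_edges_image)
  show "pairwise (\<lambda>F G. \<Union>F \<inter> \<Union>G = {}) ((\<lambda>j. graph_edges (Rj j \<times> Cj j)) ` J)"
  proof (rule pairwiseI, elim imageE, hypsubst)
    fix i j assume ij: "i \<in> J" "j \<in> J" "graph_edges (Rj i \<times> Cj i) \<noteq> graph_edges (Rj j \<times> Cj j)"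
    then have "i \<noteq> j" by blast
    then have "Rj i \<inter> Rj j = {}" "Cj i \<inter> Cj j = {}"
      using ij(1,2) disj by (simp_all add: disjoint_family_on_def)
    moreover have "Rj i \<inter> Cj j = {}" "Cj i \<inter> Rj j = {}"
      using sub[OF ij(1)] sub[OF ij(2)] assms(1) by blast+
    ultimately have "(Rj i \<union> Cj i) \<inter> (Rj j \<union> Cj j) = {}" by blast
    with V[of i] V[of j]
    show "\<Union>(graph_edges (Rj i \<times> Cj i)) \<inter> \<Union>(graph_edges (Rj j \<times> Cj j)) = {}" by blast
  qed
  show "graph_edges (\<Union>j\<in>J. Rj j \<times> Cj j) = \<Union>((\<lambda>j. graph_edges (Rj j \<times> Cj j)) ` J)"
    by (simp add: graph_edges_image image_UN)
qed

text \<open>Consecutive edges share a vertex and so lie in the same star. In a longer path its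
  centre would belong to the first and the third edge, which are disjoint.\<close>

lemma path_length_in_disjoint_stars:
  assumes "union_of_disjoint_stars E" and path: "graph_path V E s v"
  shows "s \<le> 2"
proof (rule ccontr)
  assume "\<not> s \<le> 2"
  then have s: "3 \<le> s" by simp
  obtain S where S: "\<forall>F\<in>S. star_graph F" "pairwise (\<lambda>F G. \<Union>F \<inter> \<Union>G = {}) S" "E = \<Union>S"
    using assms(1) unfolding union_of_disjoint_stars_def by (elim exE conjE) (rule that)
  have eq: "F = G" if "F \<in> S" "G \<in> S" "x \<in> e" "e \<in> F" "x \<in> e'" "e' \<in> G" for F G x e e'
  proof (rule ccontr)
    assume "F \<noteq> G"
    from pairwiseD[OF S(2) that(1,2) this] have "\<Union>F \<inter> \<Union>G = {}" .
    moreover have "x \<in> \<Union>F" "x \<in> \<Union>G" using that by blast+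
    ultimately show False by blast
  qed
  have edge: "{v i, v (Suc i)} \<in> E" if "i < s" for i
    using path that by (simp add: graph_path_def)
  have "{v 0, v 1} \<in> E" "{v 1, v 2} \<in> E" "{v 2, v 3} \<in> E"
    using edge[of 0] edge[of 1] edge[of 2] s by (simp_all add: numeral_2_eq_2 numeral_3_eq_3)
  then obtain F G H where F: "F \<in> S" "{v 0, v 1} \<in> F" and G: "G \<in> S" "{v 1, v 2} \<in> G"
    and H: "H \<in> S" "{v 2, v 3} \<in> H" using S(3) by blast
  have "F = G" by (rule eq[OF F(1) G(1) _ F(2) _ G(2), of "v 1"]) simp_all
  moreover have "H = G" by (rule eq[OF H(1) G(1) _ H(2) _ G(2), of "v 2"]) simp_all
  moreover obtain w L where "G = (\<lambda>x. {w, x}) ` L"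
    using bspec[OF S(1) G(1)] unfolding star_graph_def by blast
  ultimately have w: "w \<in> {v 0, v 1}" "w \<in> {v 2, v 3}" using F(2) H(2) by blast+
  have "v i \<noteq> v j" if "i < j" "j \<le> 3" for i j
  proof
    assume "v i = v j"
    moreover have "inj_on v {..s}" using path by (simp add: graph_path_def)
    ultimately have "i = j" using s that by (elim inj_onD) simp_all
    with that show False by simp
  qed
  from this[of 0 2] this[of 0 3] this[of 1 2] this[of 1 3]
  have "v 0 \<noteq> v 2" "v 0 \<noteq> v 3" "v 1 \<noteq> v 2" "v 1 \<noteq> v 3" by simp_all
  with w show False by blast
qed

text \<open>Otherwise \<open>r\<close>, \<open>c\<close>, \<open>r'\<close>, \<open>c'\<close> is a
  path of length 3; rows differ from columns because \<open>R\<close> and \<open>C\<close> are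
  disjoint.\<close>

lemma no_three_path_of_paths:
  fixes R C :: "'v set"
  assumes "R \<inter> C = {}" "I \<subseteq> R \<times> C"
    and paths: "\<forall>s v. graph_path (C \<union> R) (graph_edges I) s v \<longrightarrow> s \<le> 2"
    and edges: "(r, c) \<in> I" "(r', c) \<in> I" "(r', c') \<in> I"
  shows "r = r' \<or> c = c'"
proof (rule ccontr)
  assume "\<not> (r = r' \<or> c = c')"
  moreover have RC: "r \<in> R" "r' \<in> R" "c \<in> C" "c' \<in> C" using assms by auto
  ultimately have ne: "distinct [r, c, r', c']" using assms(1) by auto
  have edge: "{i, j} \<in> graph_edges I" if "(i, j) \<in> I" for i j
    using that by (force simp: graph_edges_image)
  let ?v = "(!) [r, c, r', c']"
  have "graph_path (C \<union> R) (graph_edges I) 3 ?v"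
    unfolding graph_path_def
  proof (intro conjI allI impI)
    have "{..3} = {0, 1, 2, 3 :: nat}" by auto
    then show "?v ` {..3} \<subseteq> C \<union> R" using RC by simp
    show "inj_on ?v {..3}" by (rule inj_on_nth[OF ne]) simp
    fix i :: nat assume "i < 3"
    then consider "i = 0" | "i = 1" | "i = 2" by linarith
    then show "{?v i, ?v (Suc i)} \<in> graph_edges I"
      using edge[OF edges(1)] edge[OF edges(2)] edge[OF edges(3)]
      by cases (simp_all add: insert_commute)
  qed
  with paths have "(3::nat) \<le> 2" by blast
  then show False by simp
qed

theorem corollary8p3:
  fixes R C :: "'v set" and I :: "('v \<times> 'v) set"
  assumes "countable R" and "countable C" and "R \<inter> C = {}" and "I \<subseteq> R \<times> C"
  defines "a \<equiv> \<forall>\<phi> \<in> (c0 I :: ('v \<times> 'v \<Rightarrow> 'k::{real_normed_field, euclidean_space}) set).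
      (\<exists>u. tensor_with_coeffs C R I \<phi> u) \<and>
      (\<forall>u. tensor_with_coeffs C R I \<phi> u \<longrightarrow> proj_tensor_norm C R u = sup_norm \<phi>)"
    and "b \<equiv> \<exists>(J :: nat set) Rj Cj.
      (\<forall>j\<in>J. Rj j \<subseteq> R \<and> Cj j \<subseteq> C) \<and>
      disjoint_family_on Rj J \<and> disjoint_family_on Cj J \<and>
      (\<forall>j\<in>J. is_singleton (Rj j) \<or> is_singleton (Cj j)) \<and>
      I = (\<Union>j\<in>J. Rj j \<times> Cj j)"
    and "c_stars \<equiv> union_of_disjoint_stars (graph_edges I)"
    and "c_paths \<equiv> \<forall>s v. graph_path (C \<union> R) (graph_edges I) s v \<longrightarrow> s \<le> 2"
  shows "(a \<longleftrightarrow> b) \<and> (b \<longleftrightarrow> c_stars) \<and> (c_stars \<longleftrightarrow> c_paths)"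
proof -
  have "countable I"
    using assms(1,2,4) by (meson countable_SIGMA countable_subset)
  \<comment> \<open>Both (a) and the path condition reach (b) through the hypothesis
    \<open>K\<close> of this decomposition. Countability of \<open>I\<close> lets the natural
    numbers index the blocks.\<close>
  note decomposition = star_decomposition[OF this assms(4)]
  have ab: "a \<Longrightarrow> b"
    unfolding a_def b_def by (rule decomposition) (rule isometry_imp_no_three_path[OF assms(4)])
  have ba: "b \<Longrightarrow> a"
  proof -
    assume b
    then obtain J :: "nat set" and Rj Cj where sub: "\<forall>j\<in>J. Rj j \<subseteq> R \<and> Cj j \<subseteq> C"
      and disj: "disjoint_family_on Rj J" "disjoint_family_on Cj J"
      and star: "\<forall>j\<in>J. is_singleton (Rj j) \<or> is_singleton (Cj j)"
      and I: "I = (\<Union>j\<in>J. Rj j \<times> Cj j)"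
      unfolding b_def by (elim exE conjE) (rule that)
    have bound: "proj_norm C R (coeff_tensor C R Q \<psi>) \<le> M"
      if "finite Q" "Q \<subseteq> I" "M > 0" "\<And>q. q \<in> Q \<Longrightarrow> norm (\<psi> q) \<le> M"
      for Q M and \<psi> :: "'v \<times> 'v \<Rightarrow> 'k"
      by (rule proj_norm_coeff_tensor_blocks_le[OF that(1) that(2)[unfolded I] bspec[OF sub] disj
            bspec[OF star] that(3,4)])
    show a
      unfolding a_def
      using tensor_with_coeffs_exists[OF assms(4) _ bound]
        proj_tensor_norm_with_coeffs[OF assms(4) _ bound] by blast
  qed
  have bs: "b \<Longrightarrow> c_stars"
    unfolding b_def c_stars_def
    by (elim exE conjE) (simp add: disjoint_stars_of_decomposition[OF assms(3)])
  have sp: "c_stars \<Longrightarrow> c_paths"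
    unfolding c_stars_def c_paths_def using path_length_in_disjoint_stars by blast
  have pb: "c_paths \<Longrightarrow> b"
    unfolding c_paths_def b_def
    by (rule decomposition) (rule no_three_path_of_paths[OF assms(3,4)])
  from ab ba bs sp pb show ?thesis by argo
qed

end
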